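(* Let $S=A\times B\subset\mathbb{R}^2$, where $A,B\subset\mathbb{R}$ are of SzT-type with parameter $\alpha=2$ (with corresponding constants $d(A),d(B)>0$), and are of size $n^{1/2}$ each. Assume further that $$d(A)\le d(B)\le n^{6/47}\, d(A)^{42/47}(\log n)^{-13/47}.$$ Then the number of unit-area triangles spanned by the points of $S$ is $$O\left(n^{37/17}\left(d(A)^2\, d(B)\log n\right)^{2/17}\right).$$
   Context: For finite sets $X,Y\subset\mathbb{R}$ and $s\in\mathbb{R}$, $\delta_{X,Y}(s)$ denotes the number of representations $s=x-y$ with $x\in X$, $y\in Y$. A finite set $X\subset\mathbb{R}$ is of Szemerédi–Trotter type (SzT-type) with parameter $\alpha\ge 1$ if there is a parameter $d(X)>0$ such that $$\left|\{s\in X-Y : \delta_{X,Y}(s)\ge\tau\}\right|\le \frac{d(X)\,|X|\,|Y|^{\alpha}}{\tau^3}$$ for every finite set $Y\subset\mathbb{R}$ and every real $\tau\ge 1$. When a set $X$ is said to be of SzT-type, $d(X)$ denotes such a parameter. A unit-area triangle spanned by $S$ is a (non-degenerate) triangle of area $1$ whose three vertices are points of $S$. The constant hidden in $O(\cdot)$ is absolute (independent of $n$, $A$, $B$, $d(A)$, $d(B)$); here $n\ge 2$ is such that $n^{1/2}$ is an integer. *)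

theory Defs
  imports "HOL-Analysis.Analysis"
begin

definition diff_reps :: "real set \<Rightarrow> real set \<Rightarrow> real \<Rightarrow> nat" where
  "diff_reps X Y s = card {(x, y). x \<in> X \<and> y \<in> Y \<and> s = x - y}"

definition diff_set :: "real set \<Rightarrow> real set \<Rightarrow> real set" where
  "diff_set X Y = {x - y | x y. x \<in> X \<and> y \<in> Y}"

(* d is an explicit argument because a set of this type has many admissible
   parameters; d(X) stands for any chosen one. *)
definition SzT_type :: "real \<Rightarrow> real set \<Rightarrow> real \<Rightarrow> bool" where
  "SzT_type \<alpha> X d \<longleftrightarrow>
     finite X \<and> \<alpha> \<ge> 1 \<and> d > 0 \<and>
     (\<forall>Y \<tau>. finite Y \<and> \<tau> \<ge> 1 \<longrightarrow>
        real (card {s \<in> diff_set X Y. real (diff_reps X Y s) \<ge> \<tau>})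
          \<le> d * real (card X) * real (card Y) powr \<alpha> / \<tau> ^ 3)"

definition planar_grid :: "real set \<Rightarrow> real set \<Rightarrow> (real ^ 2) set" where
  "planar_grid A B = {p. p $ 1 \<in> A \<and> p $ 2 \<in> B}"

(* A triangle is identified with the unordered set of its three vertices. *)
definition unit_area_triangles :: "(real ^ 2) set \<Rightarrow> (real ^ 2) set set" where
  "unit_area_triangles S =
     {T. T \<subseteq> S \<and> card T = 3 \<and> \<not> collinear T \<and> measure lborel (convex hull T) = 1}"

end

theory Submission
  imports Defs
begin

text \<open>
  Write \<open>k = sqrt n\<close> for the common size of \<open>A\<close> and \<open>B\<close>.  The signed doubled area of the triangle
  with vertices \<open>(c, z)\<close>, \<open>(a, x)\<close>, \<open>(b, y)\<close> is \<open>u * Y - v * X\<close>, where \<open>(u, v) = (a - c, b - c)\<close> and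
  \<open>(X, Y) = (x - z, y - z)\<close>.  Unit-area triangles are therefore counted by incidences in the plane
  between the points \<open>(X, Y)\<close> and the lines \<open>{(X, Y). u * Y - v * X = 2}\<close>, each point counted with
  the number of base points \<open>z \<in> B\<close> that realise it and each line with the number of base points
  \<open>c \<in> A\<close> that realise it.

  The SzT-property makes large weights rare.  A pair \<open>(u, v)\<close> of weight at least \<open>i\<close> has
  \<open>delta(u) \<ge> i\<close>, where \<open>delta\<close> is the representation function of \<open>A - A\<close>, and for fixed \<open>u\<close> the
  admissible \<open>v\<close> are the differences with at least \<open>i\<close> representations by \<open>A\<close> and \<open>A \<inter> (A - u)\<close>.
  The property for the latter pair bounds their number by \<open>d * k * delta(u)^2 / i^3\<close>; the property
  for \<open>A - A\<close> bounds the sum of \<open>delta(u)^2\<close> over \<open>delta(u) \<ge> i\<close> by \<open>3 * d * k^3 / i\<close>.  Together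
  at most \<open>3 * d^2 * k^4 / i^4\<close> pairs have weight at least \<open>i\<close> (lemma \<open>card_rich_SzT\<close>); for small
  \<open>i\<close> the bound \<open>k^3 / i\<close>, from the total weight \<open>k^3\<close>, is better.

  A weighted incidence count is the sum, over all pairs of thresholds \<open>i\<close>, \<open>j\<close>, of the unweighted
  counts between points of weight at least \<open>j\<close> and lines of weight at least \<open>i\<close>.  Applying the
  Szemeredi--Trotter theorem to each of them and summing gives
  \<open>O(n^(19/9) * (d(A) * d(B))^(2/9))\<close> triangles, where the parameters may be truncated at \<open>k\<close>
  (lemma \<open>card_unit_area_triangles_SzT\<close>).  With both parameters in the range from \<open>1\<close> to \<open>k\<close> this
  is at most a constant times the asserted bound, as \<open>b^(16/153) \<le> n^(8/153)\<close> for \<open>b \<le> k\<close>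
  (lemma \<open>exponent_comparison\<close>).

  The Szemeredi--Trotter theorem is derived by Szekely's method from the crossing inequality for
  graphs drawn with straight edges.  For these, the linear bound on the number of edges of a
  noncrossing drawing needs neither faces nor Euler's formula; it follows from a sweep from left to
  right (lemma \<open>noncrossing_segments_card\<close>).
\<close>

section \<open>Noncrossing straight-line graphs\<close>

text \<open>A segment is a pair of points, the left end first.\<close>

type_synonym point = "real \<times> real"
type_synonym segment = "point \<times> point"

definition left_end :: "segment \<Rightarrow> real" where "left_end e = fst (fst e)"
definition right_end :: "segment \<Rightarrow> real" where "right_end e = fst (snd e)"
definition slope :: "segment \<Rightarrow> real" where
  "slope e = (snd (snd e) - snd (fst e)) / (right_end e - left_end e)"
definition height :: "segment \<Rightarrow> real \<Rightarrow> real" where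
  "height e x = snd (fst e) + slope e * (x - left_end e)"
text \<open>
  Only abscissae interior to both segments count, so that segments which just share an end do not
  cross; overlapping segments on a common line do.
\<close>

definition crosses :: "segment \<Rightarrow> segment \<Rightarrow> bool" where
  "crosses e f \<longleftrightarrow> (\<exists>x. left_end e < x \<and> x < right_end e \<and> left_end f < x \<and> x < right_end f
     \<and> height e x = height f x)"

lemma height_right_end:
  assumes "left_end e < right_end e"
  shows "height e (right_end e) = snd (snd e)"
  using assms by (simp add: height_def slope_def)

lemma crosses_if_heights_swap:
  assumes "height e a < height f a" "height f b < height e b" "a < b"
    and "left_end e \<le> a" "left_end f \<le> a" "b \<le> right_end e" "b \<le> right_end f"
  shows "crosses e f"
proof -
  have "\<exists>x. a \<le> x \<and> x \<le> b \<and> height e x - height f x = 0"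
    using assms(1-3) by (intro IVT') (auto simp: height_def intro!: continuous_intros)
  then obtain x where x: "a \<le> x" "x \<le> b" "height e x = height f x" by auto
  moreover have "x \<noteq> a" "x \<noteq> b" using x assms(1,2) by auto
  ultimately have "left_end e < x \<and> x < right_end e \<and> left_end f < x \<and> x < right_end f"
    using assms(4-7) by linarith
  with x(3) show ?thesis unfolding crosses_def by blast
qed

lemma height_mono_slope:
  assumes "fst e = fst f" "left_end e < x"
  shows "height e x < height f x \<longleftrightarrow> slope e < slope f"
    and "height e x = height f x \<longleftrightarrow> slope e = slope f"
  using assms by (auto simp: height_def left_end_def)

text \<open>
  Call an edge topmost if it is the steepest one leaving its left end; there are at most \<open>card V\<close> of
  these.  Every other edge \<open>e\<close> has a successor \<open>up e\<close>, the next steeper edge with the same left end.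
  The two bound a wedge; sweeping from left to right, let \<open>tip e\<close> be the first vertex met in the
  closed wedge.  It exists, since the end of the shorter of the two edges lies in the wedge.  A
  vertex \<open>w\<close> is the tip of at most two edges: at most one that passes through \<open>w\<close> and at most one
  that passes below \<open>w\<close>.  Indeed, suppose that two wedges had the same tip in the same way.  Wedges
  with a common apex overlap at most along an edge through \<open>w\<close>, which is the lower edge of one and
  the upper edge of the other.  Otherwise the apex of the wedge that starts later does not lie in
  the other one, whose first vertex is \<open>w\<close>; so a bounding edge of the later wedge would have to
  cross a bounding edge of the earlier one before reaching \<open>w\<close>.  Hence there are
  at most \<open>2 * card V\<close> edges that are not topmost.
\<close>

lemma noncrossing_segments_card:
  fixes V :: "point set" and E :: "segment set"
  assumes fin: "finite V" and inj: "inj_on fst V" and EV: "E \<subseteq> V \<times> V"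
    and lr: "\<And>e. e \<in> E \<Longrightarrow> left_end e < right_end e"
    and nc: "\<And>e f. e \<in> E \<Longrightarrow> f \<in> E \<Longrightarrow> e \<noteq> f \<Longrightarrow> \<not> crosses e f"
  shows "card E \<le> 3 * card V"
proof -
  have finE: "finite E" using EV fin finite_subset by blast
  have start_eqI: "fst e = fst f" if "e \<in> E" "f \<in> E" "left_end e = left_end f" for e f
  proof -
    have "fst e \<in> V" "fst f \<in> V" using that EV by (auto simp: mem_Times_iff)
    then show ?thesis using that(3) inj by (auto simp: left_end_def dest: inj_onD)
  qed
  have slope_inj: "e = f" if ef: "e \<in> E" "f \<in> E" "fst e = fst f" "slope e = slope f" for e f
  proof (rule ccontr)
    assume "e \<noteq> f"
    define x where "x = (left_end e + min (right_end e) (right_end f)) / 2"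
    have lf: "left_end f = left_end e" using ef(3) by (simp add: left_end_def)
    have x: "left_end e < x" "x < right_end e" "x < right_end f"
      using lr[OF ef(1)] lr[OF ef(2)] lf unfolding x_def by (auto simp: min_def field_simps)
    have "crosses e f" unfolding crosses_def
      by (rule exI[of _ x]) (use x lf ef(3,4) in \<open>auto simp: height_def\<close>)
    then show False using nc ef \<open>e \<noteq> f\<close> by blast
  qed
  define above where "above e = {f \<in> E. fst f = fst e \<and> slope e < slope f}" for e
  define T where "T = {e \<in> E. above e = {}}"
  have "inj_on fst T"
  proof (rule inj_onI)
    fix e f assume "e \<in> T" "f \<in> T" "fst e = fst f"
    then show "e = f" using slope_inj[of e f] unfolding T_def above_def
      by (smt (verit, best) Collect_empty_eq mem_Collect_eq)
  qed
  then have "card T = card (fst ` T)" by (simp add: card_image)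
  also have "\<dots> \<le> card V" by (rule card_mono[OF fin]) (use EV in \<open>auto simp: T_def\<close>)
  finally have cardT: "card T \<le> card V" .
  have "\<forall>e\<in>E - T. \<exists>g. g \<in> above e \<and> (\<forall>f\<in>above e. slope g \<le> slope f)"
  proof
    fix e assume "e \<in> E - T"
    then have "finite (above e)" "above e \<noteq> {}" using finE by (auto simp: T_def above_def)
    from arg_min_if_finite[OF this, of slope] show "\<exists>g. g \<in> above e \<and> (\<forall>f\<in>above e. slope g \<le> slope f)"
      by (metis not_less)
  qed
  then obtain up where up: "\<And>e. e \<in> E - T \<Longrightarrow> up e \<in> above e"
    "\<And>e f. e \<in> E - T \<Longrightarrow> f \<in> above e \<Longrightarrow> slope (up e) \<le> slope f"
    by metis
  have upE: "up e \<in> E" "fst (up e) = fst e" "left_end (up e) = left_end e" "slope e < slope (up e)"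
    if "e \<in> E - T" for e using up(1)[OF that] by (auto simp: above_def left_end_def)
  define wedge where "wedge e = {w \<in> V. left_end e < fst w \<and> fst w \<le> right_end e \<and> fst w \<le> right_end (up e)
      \<and> height e (fst w) \<le> snd w \<and> snd w \<le> height (up e) (fst w)}" for e
  have "\<forall>e\<in>E - T. \<exists>w. w \<in> wedge e \<and> (\<forall>r\<in>wedge e. fst w \<le> fst r)"
  proof
    fix e assume e: "e \<in> E - T"
    have "snd (if right_end e \<le> right_end (up e) then e else up e) \<in> wedge e"
      using e upE[OF e] EV lr[of e] lr[of "up e"] height_right_end[of e] height_right_end[of "up e"]
        height_mono_slope(1)[of e "up e" "right_end e"] height_mono_slope(1)[of e "up e" "right_end (up e)"]
      by (auto simp: wedge_def right_end_def split: if_splits)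
    then have "wedge e \<noteq> {}" by (rule ex_in_conv[THEN iffD1, OF exI])
    moreover have "finite (wedge e)" using fin by (simp add: wedge_def)
    ultimately have "finite (wedge e)" "wedge e \<noteq> {}" by blast+
    from arg_min_if_finite[OF this, of fst] show "\<exists>w. w \<in> wedge e \<and> (\<forall>r\<in>wedge e. fst w \<le> fst r)"
      by (metis not_less)
  qed
  then obtain tip where tip: "\<And>e. e \<in> E - T \<Longrightarrow> tip e \<in> wedge e"
    "\<And>e r. e \<in> E - T \<Longrightarrow> r \<in> wedge e \<Longrightarrow> fst (tip e) \<le> fst r"
    by metis
  define code where "code e = (tip e, height e (fst (tip e)) = snd (tip e))" for e
  \<comment> \<open>By symmetry it suffices to treat the case that the wedge of \<open>f\<close> does not start before that of \<open>e\<close>.\<close>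
  have key: "e = f" if e: "e \<in> E - T" and f: "f \<in> E - T" and eq: "code e = code f"
    and le: "left_end e \<le> left_end f" for e f
  proof -
    define w where "w = tip e"
    have wf: "w = tip f" and bool: "height e (fst w) = snd w \<longleftrightarrow> height f (fst w) = snd w"
      using eq by (auto simp: code_def w_def)
    have we: "w \<in> wedge e" and we': "w \<in> wedge f" using tip(1)[OF e] tip(1)[OF f] by (simp add: w_def, simp add: wf)
    note W = we[unfolded wedge_def, simplified] and W' = we'[unfolded wedge_def, simplified]
    have se: "height e (fst w) < height (up e) (fst w)" and sf: "height f (fst w) < height (up f) (fst w)"
      using height_mono_slope(1)[of e "up e" "fst w"] height_mono_slope(1)[of f "up f" "fst w"]
        upE[OF e] upE[OF f] W W' by simp_all
    show "e = f"
    proof (cases "left_end e = left_end f")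
      case True
      then have st: "fst e = fst f" using start_eqI e f by auto
      have "\<not> slope e < slope f"
      proof
        assume "slope e < slope f"
        then have "slope (up e) \<le> slope f" using up(2)[OF e, of f] f st by (auto simp: above_def)
        then have "height (up e) (fst w) \<le> height f (fst w)"
          using height_mono_slope[of f "up e" "fst w"] st upE(2)[OF e] W' by auto
        then show False using W W' bool se sf by auto
      qed
      moreover have "\<not> slope f < slope e"
      proof
        assume "slope f < slope e"
        then have "slope (up f) \<le> slope e" using up(2)[OF f, of e] e st by (auto simp: above_def)
        then have "height (up f) (fst w) \<le> height e (fst w)"
          using height_mono_slope[of e "up f" "fst w"] st upE(2)[OF f] W by auto
        then show False using W W' bool se sf by auto
      qed
      ultimately show ?thesis using slope_inj[of e f] e f st by auto
    next
      case False
      \<comment> \<open>The apex \<open>r\<close> of the later wedge lies below or above the earlier wedge.\<close>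
      define r where "r = fst f"
      have r: "r \<in> V" "fst r = left_end f" "left_end e < fst r" "fst r < fst w"
        using EV f False le W' by (auto simp: r_def left_end_def)
      have hr: "height f (fst r) = snd r" "height (up f) (fst r) = snd r"
        using upE(2)[OF f] by (simp_all add: r_def height_def left_end_def)
      have "r \<notin> wedge e" using tip(2)[OF e, of r] r(4) by (auto simp: w_def)
      then consider "snd r < height e (fst r)" | "height (up e) (fst r) < snd r"
        using r W by (force simp: wedge_def)
      then show ?thesis
      proof cases
        case 1
        have "crosses (up f) e"
          by (rule crosses_if_heights_swap[of _ "fst r" _ "fst w"])
            (use 1 r hr W W' bool se sf upE[OF f] in auto)
        moreover have "up f \<noteq> e" using upE(3)[OF f] False by auto
        ultimately show ?thesis using nc[of "up f" e] upE(1)[OF f] e by auto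
      next
        case 2
        have "crosses (up e) f"
          by (rule crosses_if_heights_swap[of _ "fst r" _ "fst w"])
            (use 2 r hr W W' bool se sf upE[OF e] in auto)
        moreover have "up e \<noteq> f" using upE(3)[OF e] False by auto
        ultimately show ?thesis using nc[of "up e" f] upE(1)[OF e] f by auto
      qed
    qed
  qed
  have "inj_on code (E - T)"
  proof (rule inj_onI)
    fix e f assume "e \<in> E - T" "f \<in> E - T" "code e = code f"
    then show "e = f" using key[of e f] key[of f e] by (cases "left_end e \<le> left_end f") simp_all
  qed
  then have "card (E - T) = card (code ` (E - T))" by (simp add: card_image)
  also have "\<dots> \<le> card (V \<times> (UNIV :: bool set))"
    proof (rule card_mono)
    show "finite (V \<times> (UNIV :: bool set))" using fin by simp
    show "code ` (E - T) \<subseteq> V \<times> UNIV"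
    proof (rule image_subsetI)
      fix e assume "e \<in> E - T"
      from tip(1)[OF this] show "code e \<in> V \<times> UNIV" by (simp add: code_def wedge_def)
    qed
  qed
  finally have "card (E - T) \<le> 2 * card V" by (simp add: card_cartesian_product)
  moreover have "T \<union> (E - T) = E" by (auto simp: T_def)
  then have "card E \<le> card T + card (E - T)" by (metis card_Un_le)
  ultimately show ?thesis using cardT by linarith
qed

section \<open>The crossing inequality\<close>

text \<open>Deleting every edge that takes part in a crossing leaves a noncrossing graph.\<close>

lemma card_segments_le_crossings:
  fixes V :: "point set" and E :: "segment set"
  assumes fin: "finite V" and inj: "inj_on fst V" and EV: "E \<subseteq> V \<times> V"
    and lr: "\<And>e. e \<in> E \<Longrightarrow> left_end e < right_end e"
  shows "card E \<le> 3 * card V + card {(e, f). e \<in> E \<and> f \<in> E \<and> e \<noteq> f \<and> crosses e f}"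
    (is "_ \<le> _ + card ?X")
proof -
  have finE: "finite E" using EV fin finite_subset by blast
  have "finite ?X" by (rule finite_subset[of _ "E \<times> E"]) (use finE in auto)
  then have F: "finite (fst ` ?X)" "card (fst ` ?X) \<le> card ?X" by (auto intro: card_image_le)
  have "card (E - fst ` ?X) \<le> 3 * card V"
  proof (rule noncrossing_segments_card[OF fin inj])
    show "E - fst ` ?X \<subseteq> V \<times> V" using EV by blast
    show "left_end e < right_end e" if "e \<in> E - fst ` ?X" for e using that lr by blast
    show "\<not> crosses e f" if "e \<in> E - fst ` ?X" "f \<in> E - fst ` ?X" "e \<noteq> f" for e f
    proof
      assume "crosses e f"
      then have "(e, f) \<in> ?X" using that by blast
      then have "e \<in> fst ` ?X" by (rule rev_image_eqI) simp
      then show False using that by blast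
    qed
  qed
  moreover have "card E - card (fst ` ?X) \<le> card (E - fst ` ?X)"
    by (rule diff_card_le_card_Diff[OF F(1)])
  ultimately show ?thesis using F(2) by linarith
qed

text \<open>
  The probability that a random subset of \<open>V\<close>, containing each element independently with
  probability \<open>p\<close>, equals \<open>W\<close>.  Averages against it are finite sums over \<open>Pow V\<close>.
\<close>

definition sample_prob :: "real \<Rightarrow> 'a set \<Rightarrow> 'a set \<Rightarrow> real" where
  "sample_prob p V W = p ^ card W * (1 - p) ^ card (V - W)"

text \<open>
  Expand the product over \<open>v \<in> V\<close> of \<open>p + (1 - p)\<close>, with the second summand dropped for \<open>v \<in> S\<close>.
\<close>

lemma sample_prob_superset:
  assumes "finite V" "S \<subseteq> V"
  shows "(\<Sum>W\<in>Pow V. if S \<subseteq> W then sample_prob p V W else 0) = p ^ card S"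
proof -
  have "p ^ card S = (\<Prod>v\<in>V. p + (if v \<in> S then 0 else 1 - p))"
  proof -
    have "(\<Prod>v\<in>V. p + (if v \<in> S then 0 else 1 - p)) = (\<Prod>v\<in>V. if v \<in> S then p else 1)"
      by (rule prod.cong) auto
    also have "\<dots> = (\<Prod>v\<in>S. p)"
      using assms by (simp add: prod.inter_restrict[symmetric] Int_absorb1)
    finally show ?thesis by simp
  qed
  also have "\<dots> = (\<Sum>W\<in>Pow V. (\<Prod>v\<in>W. p) * (\<Prod>v\<in>V-W. if v \<in> S then 0 else 1 - p))"
    by (rule prod_add[OF assms(1)])
  also have "\<dots> = (\<Sum>W\<in>Pow V. if S \<subseteq> W then sample_prob p V W else 0)"
  proof (rule sum.cong)
    fix W assume "W \<in> Pow V"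
    show "(\<Prod>v\<in>W. p) * (\<Prod>v\<in>V-W. if v \<in> S then 0 else 1 - p) =
      (if S \<subseteq> W then sample_prob p V W else 0)"
    proof (cases "S \<subseteq> W")
      case True
      then have "(\<Prod>v\<in>V-W. if v \<in> S then 0 else 1 - p) = (\<Prod>v\<in>V-W. 1 - p)"
        by (intro prod.cong) auto
      then show ?thesis using True by (simp add: sample_prob_def)
    next
      case False
      then obtain v where "v \<in> S" "v \<in> V - W" using assms(2) by auto
      then have "(\<Prod>v\<in>V-W. if v \<in> S then 0 else 1 - p) = 0"
        using assms(1) by (intro prod_zero) auto
      then show ?thesis using False by simp
    qed
  qed simp
  finally show ?thesis by simp
qed

lemma expected_sampled_count:
  assumes "finite V" "finite I" "\<And>i. i \<in> I \<Longrightarrow> S i \<subseteq> V" "\<And>i. i \<in> I \<Longrightarrow> card (S i) = k"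
  shows "(\<Sum>W\<in>Pow V. sample_prob p V W * real (card {i \<in> I. S i \<subseteq> W})) = p ^ k * real (card I)"
proof -
  have "real (card {i \<in> I. S i \<subseteq> W}) = (\<Sum>i\<in>I. if S i \<subseteq> W then 1 else 0)" for W
    by (simp add: sum.If_cases[OF assms(2)] Collect_conj_eq)
  then have "(\<Sum>W\<in>Pow V. sample_prob p V W * real (card {i \<in> I. S i \<subseteq> W})) =
    (\<Sum>W\<in>Pow V. \<Sum>i\<in>I. sample_prob p V W * (if S i \<subseteq> W then 1 else 0))"
    by (simp only: sum_distrib_left)
  also have "\<dots> = (\<Sum>W\<in>Pow V. \<Sum>i\<in>I. if S i \<subseteq> W then sample_prob p V W else 0)"
    by (intro sum.cong refl) simp
  also have "\<dots> = (\<Sum>i\<in>I. \<Sum>W\<in>Pow V. if S i \<subseteq> W then sample_prob p V W else 0)"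
    by (rule sum.swap)
  also have "\<dots> = (\<Sum>i\<in>I. p ^ k)"
    by (rule sum.cong) (use assms in \<open>simp_all add: sample_prob_superset\<close>)
  finally show ?thesis by simp
qed

text \<open>
  The bound of \<open>card_segments_le_crossings\<close>, averaged over random induced subgraphs: a vertex
  survives with probability \<open>p\<close>, an edge with \<open>p^2\<close>, and a crossing with \<open>p^4\<close> because its two edges
  have four different ends.
\<close>

lemma crossing_inequality:
  fixes V :: "point set" and E :: "segment set" and p :: real
  defines "X \<equiv> {(e, f). e \<in> E \<and> f \<in> E \<and> e \<noteq> f \<and> crosses e f}"
  assumes fin: "finite V" and inj: "inj_on fst V" and EV: "E \<subseteq> V \<times> V"
    and lr: "\<And>e. e \<in> E \<Longrightarrow> left_end e < right_end e"
    and disj: "\<And>e f. (e, f) \<in> X \<Longrightarrow> card {fst e, snd e, fst f, snd f} = 4"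
    and p: "0 \<le> p" "p \<le> 1"
  shows "p ^ 2 * real (card E) \<le> 3 * p * real (card V) + p ^ 4 * real (card X)"
proof -
  have finE: "finite E" using EV fin finite_subset by blast
  have finX: "finite X" by (rule finite_subset[of _ "E \<times> E"]) (use finE in \<open>auto simp: X_def\<close>)
  define EW where "EW W = {e \<in> E. {fst e, snd e} \<subseteq> W}" for W
  define XW where "XW W = {c \<in> X. {fst (fst c), snd (fst c), fst (snd c), snd (snd c)} \<subseteq> W}" for W
  define VW where "VW W = {v \<in> V. {v} \<subseteq> W}" for W
  have sub: "real (card (EW W)) \<le> 3 * real (card (VW W)) + real (card (XW W))" if "W \<subseteq> V" for W
  proof -
    have VW: "VW W = W" using that by (auto simp: VW_def)
    have "card (EW W) \<le> 3 * card W + card {(e, f). e \<in> EW W \<and> f \<in> EW W \<and> e \<noteq> f \<and> crosses e f}"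
      by (rule card_segments_le_crossings)
        (use that fin inj lr in \<open>auto simp: EW_def mem_Times_iff intro: finite_subset inj_on_subset\<close>)
    also have "{(e, f). e \<in> EW W \<and> f \<in> EW W \<and> e \<noteq> f \<and> crosses e f} = XW W"
      by (auto simp: EW_def XW_def X_def)
    finally show ?thesis unfolding VW by linarith
  qed
  have nn: "0 \<le> sample_prob p V W" for W using p by (simp add: sample_prob_def)
  have "p ^ 2 * real (card E) = (\<Sum>W\<in>Pow V. sample_prob p V W * real (card (EW W)))"
    unfolding EW_def
  proof (rule expected_sampled_count[symmetric, OF fin finE])
    fix e assume e: "e \<in> E"
    then show "{fst e, snd e} \<subseteq> V" using EV by auto
    have "fst e \<noteq> snd e" using lr[OF e] by (auto simp: left_end_def right_end_def)
    then show "card {fst e, snd e} = 2" by simp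
  qed
  also have "\<dots> \<le> (\<Sum>W\<in>Pow V. sample_prob p V W * (3 * real (card (VW W)) + real (card (XW W))))"
    by (intro sum_mono mult_left_mono sub nn) auto
  also have "\<dots> = 3 * (\<Sum>W\<in>Pow V. sample_prob p V W * real (card (VW W))) +
     (\<Sum>W\<in>Pow V. sample_prob p V W * real (card (XW W)))"
    by (simp add: distrib_left sum.distrib sum_distrib_left mult_ac)
  also have "(\<Sum>W\<in>Pow V. sample_prob p V W * real (card (VW W))) = p ^ 1 * real (card V)"
    unfolding VW_def by (rule expected_sampled_count[OF fin fin]) auto
  also have "(\<Sum>W\<in>Pow V. sample_prob p V W * real (card (XW W))) = p ^ 4 * real (card X)"
    unfolding XW_def
  proof (rule expected_sampled_count[OF fin finX])
    fix c assume c: "c \<in> X"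
    then show "{fst (fst c), snd (fst c), fst (snd c), snd (snd c)} \<subseteq> V"
      using EV by (auto simp: X_def)
    show "card {fst (fst c), snd (fst c), fst (snd c), snd (snd c)} = 4"
      using disj[of "fst c" "snd c"] c by simp
  qed
  finally show ?thesis by simp
qed

section \<open>The Szemeredi--Trotter theorem\<close>

text \<open>A non-vertical line is encoded by its slope and its intercept.\<close>

definition on_line :: "point \<Rightarrow> point \<Rightarrow> bool" where
  "on_line q l \<longleftrightarrow> snd q = fst l * fst q + snd l"

definition incidences :: "('a \<Rightarrow> 'b \<Rightarrow> bool) \<Rightarrow> 'a set \<Rightarrow> 'b set \<Rightarrow> ('a \<times> 'b) set" where
  "incidences R P L = {(q, l). q \<in> P \<and> l \<in> L \<and> R q l}"

lemma lines_meet_once: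
  fixes l m :: point
  assumes "l \<noteq> m" "fst l * x + snd l = fst m * x + snd m" "fst l * y + snd l = fst m * y + snd m"
  shows "x = y"
proof -
  have "(fst l - fst m) * (x - y) = 0" using assms(2,3) by (simp add: algebra_simps)
  then consider "fst l = fst m" | "x = y" by auto
  then show ?thesis using assms(1,2) by cases (auto simp: prod_eq_iff)
qed

definition next_on_line :: "point set \<Rightarrow> point \<Rightarrow> point \<Rightarrow> point \<Rightarrow> bool" where
  "next_on_line P l q r \<longleftrightarrow> q \<in> P \<and> r \<in> P \<and> on_line q l \<and> on_line r l \<and> fst q < fst r
     \<and> (\<forall>t\<in>P. on_line t l \<longrightarrow> \<not> (fst q < fst t \<and> fst t < fst r))"

definition line_segments :: "point set \<Rightarrow> point set \<Rightarrow> segment set" where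
  "line_segments P L = {(q, r). \<exists>l\<in>L. next_on_line P l q r}"

text \<open>
  Charge the incidence of a point with a line to the segment from it to the next point on the
  line; only the last point of each line has none.  Since a segment determines its line, no segment
  is charged twice.
\<close>

lemma card_incidences_le_segments:
  assumes fin: "finite P" "finite L"
  shows "card (incidences on_line P L) \<le> card (line_segments P L) + card L"
proof -
  let ?J = "incidences on_line P L"
  have finJ: "finite ?J" by (rule finite_subset[of _ "P \<times> L"]) (use fin in \<open>auto simp: incidences_def\<close>)
  have finS: "finite (line_segments P L)"
    by (rule finite_subset[of _ "P \<times> P"]) (use fin in \<open>auto simp: line_segments_def next_on_line_def\<close>)
  define T where "T = {c \<in> ?J. \<not> (\<exists>r. next_on_line P (snd c) (fst c) r)}"
  define nx where "nx c = (SOME r. next_on_line P (snd c) (fst c) r)" for c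
  have nx: "next_on_line P (snd c) (fst c) (nx c)" if "c \<in> ?J - T" for c
    using that unfolding nx_def T_def by (auto intro: someI_ex)
  have last: "\<not> fst q < fst r" if "(q, l) \<in> T" "r \<in> P" "on_line r l" for q l r
  proof
    assume "fst q < fst r"
    define R where "R = {t \<in> P. on_line t l \<and> fst q < fst t}"
    have "r \<in> R" using that \<open>fst q < fst r\<close> by (simp add: R_def)
    then have "R \<noteq> {}" by blast
    moreover have "finite R" using fin by (simp add: R_def)
    ultimately have "finite R" "R \<noteq> {}" by blast+
    from arg_min_if_finite[OF this, of fst] obtain t where t: "t \<in> R" "\<And>u. u \<in> R \<Longrightarrow> \<not> fst u < fst t"
      by metis
    then have "next_on_line P l q t" using that
      unfolding next_on_line_def R_def T_def incidences_def by auto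
    moreover have "\<nexists>r. next_on_line P l q r" using that(1) by (simp add: T_def del: split_paired_Ex)
    ultimately show False by blast
  qed
  have "inj_on snd T"
  proof (rule inj_onI)
    fix c d assume cd: "c \<in> T" "d \<in> T" "snd c = snd d"
    obtain q l where c: "c = (q, l)" by (meson surj_pair)
    obtain r where d: "d = (r, l)" using cd c by (metis prod.collapse snd_conv)
    have on: "q \<in> P" "r \<in> P" "on_line q l" "on_line r l"
      using cd unfolding c d T_def incidences_def by auto
    then have "fst q = fst r" using last[of q l r] last[of r l q] cd unfolding c d by force
    then show "c = d" using on by (simp add: c d on_line_def prod_eq_iff)
  qed
  then have "card T = card (snd ` T)" by (simp add: card_image)
  also have "\<dots> \<le> card L" by (rule card_mono[OF fin(2)]) (auto simp: T_def incidences_def)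
  finally have T: "card T \<le> card L" .
  have "inj_on (\<lambda>c. (fst c, nx c)) (?J - T)"
  proof (rule inj_onI)
    fix c d assume cd: "c \<in> ?J - T" "d \<in> ?J - T" "(fst c, nx c) = (fst d, nx d)"
    have eq: "fst d = fst c" "nx d = nx c" using cd(3) by auto
    have "snd c = snd d"
    proof (rule ccontr)
      assume "snd c \<noteq> snd d"
      from lines_meet_once[OF this, of "fst (fst c)" "fst (nx c)"] nx[OF cd(1)] nx[OF cd(2)]
      show False unfolding next_on_line_def on_line_def eq by auto
    qed
    then show "c = d" using eq by (simp add: prod_eq_iff)
  qed
  then have "card (?J - T) = card ((\<lambda>c. (fst c, nx c)) ` (?J - T))" by (simp add: card_image)
  also have "\<dots> \<le> card (line_segments P L)"
  proof (rule card_mono[OF finS], rule image_subsetI)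
    fix c assume c: "c \<in> ?J - T"
    then have "snd c \<in> L" by (auto simp: incidences_def)
    with nx[OF c] show "(fst c, nx c) \<in> line_segments P L" by (auto simp: line_segments_def)
  qed
  finally have "card (?J - T) \<le> card (line_segments P L)" .
  moreover have "card ?J \<le> card T + card (?J - T)"
  proof -
    have "T \<union> (?J - T) = ?J" by (auto simp: T_def)
    then show ?thesis by (metis card_Un_le)
  qed
  ultimately show ?thesis using T by linarith
qed

text \<open>
  Segments on one line have disjoint interiors, so the edges of a crossing come from two different
  lines.  These meet in one point only: it determines the two segments, and as it is interior to
  both of them they cannot share an end.
\<close>

lemma card_line_segments_crossings:
  fixes P L :: "point set"
  assumes fin: "finite P" "finite L" and inj: "inj_on fst P"
  defines "E \<equiv> line_segments P L"
  defines "X \<equiv> {(e, f). e \<in> E \<and> f \<in> E \<and> e \<noteq> f \<and> crosses e f}"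
  shows "card X \<le> card L ^ 2"
    and "\<And>e f. (e, f) \<in> X \<Longrightarrow> card {fst e, snd e, fst f, snd f} = 4"
proof -
  define ln where "ln e = (SOME l. l \<in> L \<and> next_on_line P l (fst e) (snd e))" for e
  have ln: "ln e \<in> L" "next_on_line P (ln e) (fst e) (snd e)" if "e \<in> E" for e
  proof -
    have "\<exists>l. l \<in> L \<and> next_on_line P l (fst e) (snd e)"
      using that unfolding E_def line_segments_def by (auto simp del: split_paired_Ex)
    from someI_ex[OF this] show "ln e \<in> L" "next_on_line P (ln e) (fst e) (snd e)"
      by (simp_all add: ln_def)
  qed
  have height: "height e x = fst (ln e) * x + snd (ln e)" if "e \<in> E" for e x
  proof -
    have "snd (snd e) - snd (fst e) = fst (ln e) * (right_end e - left_end e)" "left_end e < right_end e"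
      and le: "snd (fst e) = fst (ln e) * left_end e + snd (ln e)"
      using ln(2)[OF that] by (auto simp: next_on_line_def on_line_def left_end_def right_end_def algebra_simps)
    then have "slope e = fst (ln e)" by (simp add: slope_def)
    then show ?thesis by (simp add: height_def le algebra_simps)
  qed
  have same_line: "e = f"
    if ef: "e \<in> E" "f \<in> E" "ln e = ln f" "left_end e < x" "x < right_end e" "left_end f < x" "x < right_end f"
    for e f x
  proof -
    note N = ln(2)[OF ef(1), unfolded next_on_line_def] ln(2)[OF ef(2), unfolded next_on_line_def, folded ef(3)]
    have "\<not> left_end e < left_end f" "\<not> left_end f < left_end e"
      "\<not> right_end e < right_end f" "\<not> right_end f < right_end e"
      using N ef(4-7) unfolding left_end_def right_end_def by (metis less_trans)+
    then have "fst (fst e) = fst (fst f)" "fst (snd e) = fst (snd f)"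
      by (simp_all add: left_end_def right_end_def)
    then have "fst e = fst f" "snd e = snd f" using N inj by (simp_all add: inj_onD)
    then show "e = f" by (simp add: prod_eq_iff)
  qed
  have cross: "\<exists>x. left_end e < x \<and> x < right_end e \<and> left_end f < x \<and> x < right_end f \<and> ln e \<noteq> ln f
      \<and> fst (ln e) * x + snd (ln e) = fst (ln f) * x + snd (ln f)" if "(e, f) \<in> X" for e f
  proof -
    have ef: "e \<in> E" "f \<in> E" "e \<noteq> f" "crosses e f" using that by (auto simp: X_def)
    then obtain x where x: "left_end e < x" "x < right_end e" "left_end f < x" "x < right_end f"
      "height e x = height f x" by (auto simp: crosses_def)
    then have "ln e \<noteq> ln f" using same_line[of e f x] ef by blast
    then show ?thesis using x ef height by metis
  qed
  have "inj_on (\<lambda>(e, f). (ln e, ln f)) X"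
  proof (rule inj_onI)
    fix c d assume cd: "c \<in> X" "d \<in> X" "(case c of (e, f) \<Rightarrow> (ln e, ln f)) = (case d of (e, f) \<Rightarrow> (ln e, ln f))"
    obtain e f e' f' where c: "c = (e, f)" and d: "d = (e', f')" by (meson surj_pair)
    have eq: "ln e' = ln e" "ln f' = ln f" using cd(3) by (auto simp: c d)
    have E: "e \<in> E" "f \<in> E" "e' \<in> E" "f' \<in> E" using cd by (auto simp: c d X_def)
    obtain x where x: "left_end e < x" "x < right_end e" "left_end f < x" "x < right_end f" "ln e \<noteq> ln f"
      "fst (ln e) * x + snd (ln e) = fst (ln f) * x + snd (ln f)" using cross cd(1) c by blast
    obtain y where y: "left_end e' < y" "y < right_end e'" "left_end f' < y" "y < right_end f'"
      "fst (ln e) * y + snd (ln e) = fst (ln f) * y + snd (ln f)" using cross[of e' f'] cd(2) d eq by auto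
    have "x = y" by (rule lines_meet_once[OF x(5,6) y(5)])
    then show "c = d" using same_line[of e e' x] same_line[of f f' x] E eq x y by (simp add: c d)
  qed
  then have "card X = card ((\<lambda>(e, f). (ln e, ln f)) ` X)" by (simp add: card_image)
  also have "\<dots> \<le> card (L \<times> L)"
    by (rule card_mono) (use fin ln(1) in \<open>auto simp: X_def\<close>)
  finally show "card X \<le> card L ^ 2" by (simp add: card_cartesian_product power2_eq_square)
  show "card {fst e, snd e, fst f, snd f} = 4" if ef: "(e, f) \<in> X" for e f
  proof -
    obtain x where x: "left_end e < x" "x < right_end e" "left_end f < x" "x < right_end f" "ln e \<noteq> ln f"
      "fst (ln e) * x + snd (ln e) = fst (ln f) * x + snd (ln f)" using cross[OF ef] by blast
    have E: "e \<in> E" "f \<in> E" using ef by (auto simp: X_def)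
    have "v \<noteq> w" if "v \<in> {fst e, snd e}" "w \<in> {fst f, snd f}" for v w
    proof
      assume "v = w"
      have "on_line v (ln e)" "on_line v (ln f)"
        using that ln(2)[OF E(1)] ln(2)[OF E(2)] \<open>v = w\<close> by (auto simp: next_on_line_def)
      then have "fst (ln e) * fst v + snd (ln e) = fst (ln f) * fst v + snd (ln f)"
        by (simp add: on_line_def)
      from lines_meet_once[OF x(5) this x(6)] show False
        using that(1) x(1,2) by (auto simp: left_end_def right_end_def)
    qed
    then have "fst e \<noteq> fst f" "fst e \<noteq> snd f" "snd e \<noteq> fst f" "snd e \<noteq> snd f" by blast+
    moreover have "fst e \<noteq> snd e" "fst f \<noteq> snd f"
      using ln(2)[OF E(1)] ln(2)[OF E(2)] by (auto simp: next_on_line_def)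
    ultimately show ?thesis by simp
  qed
qed

text \<open>
  In the crossing inequality there are \<open>m\<close> vertices and at most \<open>n^2\<close> crossings.  The sampling
  probability \<open>p = (m / n^2)^(1/3)\<close> makes its two terms of equal order; where this value exceeds
  \<open>1\<close>, the choice \<open>p = 1\<close> already gives a linear bound.
\<close>

lemma szemeredi_trotter_distinct_abscissae:
  fixes P L :: "point set"
  assumes fin: "finite P" "finite L" and inj: "inj_on fst P"
  shows "real (card (incidences on_line P L)) \<le>
    4 * (real (card P) * real (card L)) powr (2/3) + 4 * real (card P) + real (card L)"
proof (cases "card P = 0 \<or> card L = 0")
  case True
  then have "incidences on_line P L = {}" using fin by (auto simp: incidences_def)
  then show ?thesis by simp
next
  case False
  define m n where "m = real (card P)" and "n = real (card L)"
  have mn: "m > 0" "n > 0" using False by (simp_all add: m_def n_def)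
  define E where "E = line_segments P L"
  define X where "X = {(e, f). e \<in> E \<and> f \<in> E \<and> e \<noteq> f \<and> crosses e f}"
  note X = card_line_segments_crossings[OF fin inj, folded E_def, folded X_def]
  have "real (card X) \<le> real (card L ^ 2)" using X(1) by (rule of_nat_mono)
  then have X1: "real (card X) \<le> n ^ 2" by (simp add: n_def)
  have key: "real (card E) \<le> 3 * m / p + p ^ 2 * n ^ 2" if p: "0 < p" "p \<le> 1" for p
  proof -
    have "p ^ 2 * real (card E) \<le> 3 * p * m + p ^ 4 * real (card X)"
      unfolding m_def X_def
    proof (rule crossing_inequality[OF fin(1) inj])
      show "E \<subseteq> P \<times> P" by (auto simp: E_def line_segments_def next_on_line_def)
      show "left_end e < right_end e" if "e \<in> E" for e
        using that by (auto simp: E_def line_segments_def next_on_line_def left_end_def right_end_def)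
      show "card {fst e, snd e, fst f, snd f} = 4"
        if "(e, f) \<in> {(e, f). e \<in> E \<and> f \<in> E \<and> e \<noteq> f \<and> crosses e f}" for e f
        using X(2)[unfolded X_def, OF that] .
    qed (use p in auto)
    also have "\<dots> \<le> 3 * p * m + p ^ 4 * n ^ 2" using X1 p by (intro add_left_mono mult_left_mono) auto
    also have "\<dots> = p ^ 2 * (3 * m / p + p ^ 2 * n ^ 2)"
      using p by (simp add: power2_eq_square power4_eq_xxxx field_simps)
    finally show ?thesis using p by (simp add: mult_le_cancel_left_pos)
  qed
  have "real (card E) \<le> 4 * (m * n) powr (2/3) + 4 * m"
  proof (cases "m \<le> n ^ 2")
    case True
    \<comment> \<open>With cube roots \<open>a\<close> and \<open>b\<close> of \<open>m\<close> and \<open>n\<close>, the sampling probability is \<open>a / b^2\<close>.\<close>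
    define a b where "a = m powr (1/3)" and "b = n powr (1/3)"
    have ab: "a > 0" "b > 0" "m = a ^ 3" "n = b ^ 3"
      using mn by (simp_all add: a_def b_def powr_powr flip: powr_numeral)
    have "a ^ 3 \<le> (b ^ 2) ^ 3" using True ab by (simp flip: power_mult)
    then have "a \<le> b ^ 2"
      using ab power_strict_mono[of "b ^ 2" a 3] by (simp only: not_less[symmetric]) force
    then have p: "0 < a / b ^ 2" "a / b ^ 2 \<le> 1" using ab by (simp_all add: field_simps)
    have "(m * n) powr (2/3) = a powr 2 * b powr 2"
      using mn by (simp add: a_def b_def powr_powr powr_mult)
    then have "(m * n) powr (2/3) = a ^ 2 * b ^ 2" using ab by simp
    moreover have "3 * m / (a / b ^ 2) = 3 * (a ^ 2 * b ^ 2)" "(a / b ^ 2) ^ 2 * n ^ 2 = a ^ 2 * b ^ 2"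
      using ab by (simp_all add: power2_eq_square power3_eq_cube field_simps)
    ultimately have "real (card E) \<le> 3 * (m * n) powr (2/3) + (m * n) powr (2/3)"
      using key[OF p] by (simp only:)
    then show ?thesis using mn by linarith
  next
    case False
    moreover have "0 \<le> (m * n) powr (2/3)" by simp
    ultimately show ?thesis using key[of 1] by (simp del: powr_ge_zero)
  qed
  moreover have "card (incidences on_line P L) \<le> card E + card L"
    unfolding E_def by (rule card_incidences_le_segments[OF fin])
  ultimately show ?thesis by (simp add: m_def n_def)
qed

text \<open>
  For difference pairs \<open>q = (X, Y)\<close> and \<open>l = (u, v)\<close> the relation says that the triangle with
  vertices \<open>(c, z)\<close>, \<open>(c + u, z + X)\<close>, \<open>(c + v, z + Y)\<close> has signed area \<open>1\<close>.  For fixed \<open>l \<noteq> (0, 0)\<close>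
  it is a line in the plane of \<open>q\<close>.
\<close>

definition spans_unit_area :: "point \<Rightarrow> point \<Rightarrow> bool" where
  "spans_unit_area q l \<longleftrightarrow> fst l * snd q - snd l * fst q = 2"

text \<open>
  The shear \<open>(X, Y) \<mapsto> (X + t * Y, Y)\<close> carries the line \<open>u * Y - v * X = 2\<close> to the line with slope
  \<open>v / (u + t * v)\<close> and intercept \<open>2 / (u + t * v)\<close>.  All but finitely many \<open>t\<close> make the abscissae
  of the given points distinct and keep every given line from becoming vertical.
\<close>

lemma szemeredi_trotter_difference_pairs:
  assumes fin: "finite P" "finite L"
  shows "real (card (incidences spans_unit_area P L)) \<le>
    4 * (real (card P) * real (card L)) powr (2/3) + 4 * real (card P) + real (card L)"
proof -
  define L' where "L' = L - {(0, 0)}"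
  \<comment> \<open>Where the denominator vanishes, the quotient only adds the harmless value \<open>0\<close>.\<close>
  define bad where "bad = (\<lambda>(p, q). - (fst p - fst q) / (snd p - snd q)) ` (P \<times> P)
    \<union> (\<lambda>l. - fst l / snd l) ` L"
  have "finite bad" using fin by (simp add: bad_def)
  then obtain t where t: "t \<notin> bad" using ex_new_if_finite[OF infinite_UNIV_char_0] by blast
  have tP: "- (fst p - fst q) / (snd p - snd q) \<noteq> t" if "p \<in> P" "q \<in> P" for p q
  proof -
    have "- (fst p - fst q) / (snd p - snd q) \<in> bad"
      unfolding bad_def by (rule UnI1, rule image_eqI[of _ _ "(p, q)"]) (use that in auto)
    then show ?thesis using t by metis
  qed
  have tL: "- fst l / snd l \<noteq> t" if "l \<in> L" for l
    using t that by (auto simp: bad_def)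
  define g where "g q = (fst q + t * snd q, snd q)" for q :: point
  define w where "w l = fst l + t * snd l" for l :: point
  define h where "h l = (snd l / w l, 2 / w l)" for l :: point
  have w: "w l \<noteq> 0" if l: "l \<in> L'" for l
  proof (cases "snd l = 0")
    case True
    then show ?thesis using l by (auto simp: w_def L'_def prod_eq_iff)
  next
    case False
    have "l \<in> L" using l by (simp add: L'_def)
    from tL[OF this] False show ?thesis by (auto simp: w_def field_simps)
  qed
  have inj: "inj_on fst (g ` P)"
  proof (rule inj_onI)
    fix a b assume "a \<in> g ` P" "b \<in> g ` P" "fst a = fst b"
    then obtain p q where pq: "p \<in> P" "q \<in> P" "a = g p" "b = g q"
      and eq: "fst p - fst q = - (t * (snd p - snd q))" by (auto simp: g_def algebra_simps)
    have "snd p = snd q"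
    proof (rule ccontr)
      assume "snd p \<noteq> snd q"
      then have "- (fst p - fst q) / (snd p - snd q) = t" by (simp add: eq)
      then show False using tP pq by blast
    qed
    with eq show "a = b" by (simp add: pq g_def)
  qed
  have iff: "on_line (g q) (h l) \<longleftrightarrow> spans_unit_area q l" if "l \<in> L'" for q l
  proof -
    have "on_line (g q) (h l) \<longleftrightarrow> snd q = (snd l * (fst q + t * snd q) + 2) / w l"
      by (simp add: on_line_def g_def h_def add_divide_distrib)
    also have "\<dots> \<longleftrightarrow> snd q * w l = snd l * (fst q + t * snd q) + 2"
      using w[OF that] by (simp add: eq_divide_eq)
    also have "\<dots> \<longleftrightarrow> spans_unit_area q l" by (auto simp: spans_unit_area_def w_def algebra_simps)
    finally show ?thesis .
  qed
  have injg: "inj_on g P" by (rule inj_onI) (auto simp: g_def prod_eq_iff)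
  have injh: "inj_on h L'"
  proof (rule inj_onI)
    fix l m assume lm: "l \<in> L'" "m \<in> L'" "h l = h m"
    then have "w l = w m" using w by (simp add: h_def field_simps)
    moreover have "snd l = snd m" using lm w[of m] \<open>w l = w m\<close> by (simp add: h_def)
    ultimately show "l = m" by (simp add: w_def prod_eq_iff)
  qed
  have finI: "finite (incidences on_line (g ` P) (h ` L'))"
    by (rule finite_subset[of _ "g ` P \<times> h ` L'"]) (use fin in \<open>auto simp: incidences_def L'_def\<close>)
  have inj2: "inj_on (map_prod g h) (incidences spans_unit_area P L)"
    by (rule inj_on_subset[OF map_prod_inj_on[OF injg injh]])
      (auto simp: incidences_def L'_def spans_unit_area_def)
  have "card (incidences spans_unit_area P L) = card (map_prod g h ` incidences spans_unit_area P L)"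
    using inj2 by (simp add: card_image)
  also have "\<dots> \<le> card (incidences on_line (g ` P) (h ` L'))"
  proof (rule card_mono[OF finI], rule image_subsetI)
    fix c assume c: "c \<in> incidences spans_unit_area P L"
    then have "snd c \<in> L'" "fst c \<in> P" "spans_unit_area (fst c) (snd c)"
      by (auto simp: incidences_def L'_def spans_unit_area_def)
    then show "map_prod g h c \<in> incidences on_line (g ` P) (h ` L')"
      using iff by (auto simp: incidences_def map_prod_def split_beta)
  qed
  finally have "real (card (incidences spans_unit_area P L)) \<le> real (card (incidences on_line (g ` P) (h ` L')))"
    by simp
  also have "\<dots> \<le> 4 * (real (card (g ` P)) * real (card (h ` L'))) powr (2/3)
      + 4 * real (card (g ` P)) + real (card (h ` L'))"
    by (rule szemeredi_trotter_distinct_abscissae) (use fin inj in \<open>auto simp: L'_def\<close>)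
  also have "card (g ` P) = card P" using injg by (simp add: card_image)
  also have "card (h ` L') = card L'" using injh by (simp add: card_image)
  also have "4 * (real (card P) * real (card L')) powr (2/3) + 4 * real (card P) + real (card L')
      \<le> 4 * (real (card P) * real (card L)) powr (2/3) + 4 * real (card P) + real (card L)"
  proof -
    have "card L' \<le> card L" using fin by (auto simp: L'_def intro: card_mono)
    then show ?thesis by (intro add_mono mult_left_mono powr_mono2) auto
  qed
  finally show ?thesis .
qed

section \<open>Difference pairs with many base points\<close>

text \<open>
  The base points \<open>c\<close> of triples \<open>(c + u, c + v, c)\<close> in \<open>A\<close> with the prescribed difference pair
  \<open>(u, v)\<close>.
\<close>

definition fibre :: "real set \<Rightarrow> point \<Rightarrow> real set" where
  "fibre A w = {c \<in> A. c + fst w \<in> A \<and> c + snd w \<in> A}"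

definition fibre_size :: "real set \<Rightarrow> point \<Rightarrow> nat" where
  "fibre_size A w = card (fibre A w)"

definition rich :: "real set \<Rightarrow> nat \<Rightarrow> point set" where
  "rich A i = {w. i \<le> fibre_size A w}"

lemma finite_fibre: "finite A \<Longrightarrow> finite (fibre A w)"
  by (simp add: fibre_def)

lemma fibre_size_le_card: "finite A \<Longrightarrow> fibre_size A w \<le> card A"
  unfolding fibre_size_def by (rule card_mono) (auto simp: fibre_def)

lemma finite_rich:
  assumes "finite A" "i \<ge> 1"
  shows "finite (rich A i)"
proof (rule finite_subset)
  show "finite ((\<lambda>(a, b, c). (a - c, b - c)) ` (A \<times> A \<times> A))" using assms(1) by simp
  show "rich A i \<subseteq> (\<lambda>(a, b, c). (a - c, b - c)) ` (A \<times> A \<times> A)"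
  proof
    fix w assume "w \<in> rich A i"
    then have "card (fibre A w) \<noteq> 0" using assms(2) by (simp add: rich_def fibre_size_def)
    then obtain c where "c \<in> fibre A w" by fastforce
    then show "w \<in> (\<lambda>(a, b, c). (a - c, b - c)) ` (A \<times> A \<times> A)"
      by (intro image_eqI[of _ _ "(c + fst w, c + snd w, c)"]) (auto simp: fibre_def prod_eq_iff)
  qed
qed

text \<open>The fibres over distinct difference pairs come from distinct triples of elements of \<open>A\<close>.\<close>

lemma sum_fibre_size_le:
  assumes "finite A"
  shows "(\<Sum>w\<in>rich A 1. fibre_size A w) \<le> card A ^ 3"
proof -
  have "(\<Sum>w\<in>rich A 1. fibre_size A w) = card (SIGMA w:rich A 1. fibre A w)"
    using assms by (subst card_SigmaI) (simp_all add: finite_rich finite_fibre fibre_size_def)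
  also have "\<dots> = card ((\<lambda>(w, c). (c + fst w, c + snd w, c)) ` (SIGMA w:rich A 1. fibre A w))"
    by (rule card_image[symmetric]) (auto simp: inj_on_def)
  also have "\<dots> \<le> card (A \<times> A \<times> A)"
    by (rule card_mono) (use assms in \<open>auto simp: fibre_def\<close>)
  finally show ?thesis by (simp add: card_cartesian_product power3_eq_cube)
qed

lemma rich_antimono: "i \<le> j \<Longrightarrow> rich A j \<subseteq> rich A i"
  by (auto simp: rich_def)

lemma card_rich_trivial:
  assumes "finite A" "i \<ge> 1"
  shows "real (card (rich A i)) \<le> real (card A) ^ 3 / real i"
proof -
  have "i * card (rich A i) = (\<Sum>w\<in>rich A i. i)" by simp
  also have "\<dots> \<le> (\<Sum>w\<in>rich A i. fibre_size A w)" by (rule sum_mono) (simp add: rich_def)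
  also have "\<dots> \<le> (\<Sum>w\<in>rich A 1. fibre_size A w)"
    by (rule sum_mono2) (use assms rich_antimono in \<open>auto simp: finite_rich\<close>)
  also have "\<dots> \<le> card A ^ 3" by (rule sum_fibre_size_le[OF assms(1)])
  finally have "real (i * card (rich A i)) \<le> real (card A ^ 3)" by (rule of_nat_mono)
  then show ?thesis using assms(2) by (simp add: field_simps)
qed

text \<open>
  The layer-cake decomposition, by which weighted counts reduce to counts of rich pairs.
\<close>

lemma fibre_size_layers:
  assumes "finite A"
  shows "fibre_size A w = (\<Sum>i=1..card A. if w \<in> rich A i then 1 else 0)"
proof -
  have "{1..card A} \<inter> {i. w \<in> rich A i} = {1..fibre_size A w}"
    using fibre_size_le_card[OF assms, of w] by (auto simp: rich_def)
  then show ?thesis by (simp add: sum.If_cases)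
qed

lemma sum_card_rich_le:
  assumes "finite A"
  shows "(\<Sum>i=1..card A. card (rich A i)) \<le> card A ^ 3"
proof -
  have "card (rich A i) = (\<Sum>w\<in>rich A 1. if w \<in> rich A i then 1 else 0)" if "i \<in> {1..card A}" for i
  proof -
    have "rich A 1 \<inter> {w. w \<in> rich A i} = rich A i" using rich_antimono[of 1 i A] that by auto
    then show ?thesis using finite_rich[OF assms, of 1] by (simp add: sum.If_cases)
  qed
  then have "(\<Sum>i=1..card A. card (rich A i)) =
      (\<Sum>i=1..card A. \<Sum>w\<in>rich A 1. if w \<in> rich A i then 1 else 0)" by (rule sum.cong[OF refl])
  also have "\<dots> = (\<Sum>w\<in>rich A 1. fibre_size A w)"
    by (subst sum.swap) (intro sum.cong refl fibre_size_layers[OF assms, symmetric])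
  finally show ?thesis using sum_fibre_size_le[OF assms] by simp
qed

lemma sum_inverse_squares:
  assumes "i \<ge> 1" "i \<le> M"
  shows "(\<Sum>t=Suc i..M. 1 / real t ^ 2) \<le> 1 / real i - 1 / real M"
  using assms(2)
proof (induction M rule: dec_induct)
  case base
  then show ?case by simp
next
  case (step M)
  have M: "real M \<ge> 1" using step(1) assms(1) by linarith
  have "1 / real (Suc M) ^ 2 \<le> 1 / (real M * real (Suc M))"
    using M by (intro divide_left_mono) (auto simp: power2_eq_square)
  also have "\<dots> = 1 / real M - 1 / real (Suc M)" using M by (simp add: field_simps)
  finally show ?case using step by simp
qed

text \<open>
  Writing \<open>f(u)^2\<close> as \<open>i^2\<close> plus the sum of \<open>2 * t - 1\<close> over \<open>i < t \<le> f(u)\<close> turns the left-hand side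
  into a sum over the level sets of \<open>f\<close>, where the cubic decay of their sizes leaves the convergent
  tail of \<open>1 / t^2\<close>.
\<close>

lemma sum_squares_tail:
  fixes f :: "'a \<Rightarrow> nat"
  assumes fin: "finite S" and c: "c \<ge> 0" and i: "i \<ge> 1"
    and bound: "\<And>t. t \<ge> 1 \<Longrightarrow> real (card {u \<in> S. t \<le> f u}) \<le> c / real t ^ 3"
  shows "(\<Sum>u\<in>{u \<in> S. i \<le> f u}. real (f u) ^ 2) \<le> 3 * c / real i"
proof -
  let ?S = "\<lambda>t. {u \<in> S. t \<le> f u}"
  define M where "M = i + Max (insert 0 (f ` S))"
  have M: "i \<le> M" "\<And>u. u \<in> S \<Longrightarrow> f u \<le> M"
    using fin by (auto simp: M_def intro!: trans_le_add2 Max_ge)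
  have sq: "real m ^ 2 = real i ^ 2 + (\<Sum>t=Suc i..m. 2 * real t - 1)" if "i \<le> m" for m
    using that by (induction m rule: dec_induct) (auto simp: power2_eq_square algebra_simps)
  have "(\<Sum>u\<in>?S i. real (f u) ^ 2) =
      (\<Sum>u\<in>?S i. real i ^ 2 + (\<Sum>t=Suc i..M. if t \<le> f u then 2 * real t - 1 else 0))"
  proof (rule sum.cong[OF refl])
    fix u assume u: "u \<in> ?S i"
    have "{Suc i..M} \<inter> {t. t \<le> f u} = {Suc i..f u}" using M(2)[of u] u by auto
    then show "real (f u) ^ 2 = real i ^ 2 + (\<Sum>t=Suc i..M. if t \<le> f u then 2 * real t - 1 else 0)"
      using sq[of "f u"] u by (simp add: sum.If_cases)
  qed
  also have "\<dots> = real i ^ 2 * real (card (?S i)) +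
      (\<Sum>t=Suc i..M. \<Sum>u\<in>?S i. if t \<le> f u then 2 * real t - 1 else 0)"
    by (simp add: sum.distrib, subst sum.swap, simp)
  also have "(\<Sum>t=Suc i..M. \<Sum>u\<in>?S i. if t \<le> f u then 2 * real t - 1 else 0) =
      (\<Sum>t=Suc i..M. (2 * real t - 1) * real (card (?S t)))"
  proof (rule sum.cong[OF refl])
    fix t assume t: "t \<in> {Suc i..M}"
    have "?S i \<inter> {u. t \<le> f u} = ?S t" using t by auto
    then show "(\<Sum>u\<in>?S i. if t \<le> f u then 2 * real t - 1 else 0) = (2 * real t - 1) * real (card (?S t))"
      using fin by (simp add: sum.If_cases)
  qed
  also have "\<dots> \<le> (\<Sum>t=Suc i..M. 2 * c * (1 / real t ^ 2))"
  proof (rule sum_mono)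
    fix t assume t: "t \<in> {Suc i..M}"
    then have "(2 * real t - 1) * real (card (?S t)) \<le> 2 * real t * (c / real t ^ 3)"
      using bound[of t] i c by (intro mult_mono) auto
    also have "\<dots> = 2 * c * (1 / real t ^ 2)" using t by (simp add: power2_eq_square power3_eq_cube)
    finally show "(2 * real t - 1) * real (card (?S t)) \<le> 2 * c * (1 / real t ^ 2)" .
  qed
  also have "\<dots> = 2 * c * (\<Sum>t=Suc i..M. 1 / real t ^ 2)" by (simp only: sum_distrib_left)
  also have "\<dots> \<le> 2 * c * (1 / real i)"
    using sum_inverse_squares[OF i M(1)] c by (intro mult_left_mono) (auto intro: order_trans)
  also have "real i ^ 2 * real (card (?S i)) \<le> real i ^ 2 * (c / real i ^ 3)"
    using bound[OF i] by (intro mult_left_mono) auto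
  also have "real i ^ 2 * (c / real i ^ 3) + 2 * c * (1 / real i) = 3 * c / real i"
    using i by (simp add: power2_eq_square power3_eq_cube field_simps)
  finally show ?thesis by simp
qed

text \<open>
  For \<open>t \<ge> 1\<close> a number with \<open>t\<close> representations is a difference, so the restriction to the difference
  set can be dropped.
\<close>

lemma SzT_type_card:
  assumes "SzT_type 2 A d" "finite Y" "t \<ge> 1"
  shows "real (card {s. t \<le> diff_reps A Y s}) \<le> d * real (card A) * real (card Y) ^ 2 / real t ^ 3"
    and "finite {s. t \<le> diff_reps A Y s}"
proof -
  have finA: "finite A" using assms(1) by (simp add: SzT_type_def)
  have D: "{s. t \<le> diff_reps A Y s} = {s \<in> diff_set A Y. real (diff_reps A Y s) \<ge> real t}"
  proof -
    have "s \<in> diff_set A Y" if "t \<le> diff_reps A Y s" for s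
    proof -
      have "{(x, y). x \<in> A \<and> y \<in> Y \<and> s = x - y} \<noteq> {}"
        using that assms(3) unfolding diff_reps_def by force
      then show ?thesis by (auto simp: diff_set_def)
    qed
    then show ?thesis by auto
  qed
  have "real (card {s \<in> diff_set A Y. real (diff_reps A Y s) \<ge> real t})
      \<le> d * real (card A) * real (card Y) powr 2 / real t ^ 3"
  proof -
    have "finite Y \<and> real t \<ge> 1 \<longrightarrow> real (card {s \<in> diff_set A Y. real (diff_reps A Y s) \<ge> real t})
        \<le> d * real (card A) * real (card Y) powr 2 / real t ^ 3"
      using assms(1) unfolding SzT_type_def by blast
    then show ?thesis using assms(2,3) by simp
  qed
  then show "real (card {s. t \<le> diff_reps A Y s}) \<le> d * real (card A) * real (card Y) ^ 2 / real t ^ 3"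
    unfolding D by (cases "card Y = 0") auto
  have "diff_set A Y = (\<lambda>(x, y). x - y) ` (A \<times> Y)" by (auto simp: diff_set_def)
  then have "finite (diff_set A Y)" using finA assms(2) by simp
  then show "finite {s. t \<le> diff_reps A Y s}" unfolding D by simp
qed

text \<open>
  The fibre over \<open>(u, v)\<close> consists of the representations of \<open>v\<close> as a difference of an element of
  \<open>A\<close> and one of \<open>A \<inter> (A - u)\<close>, and the latter set has as many elements as \<open>u\<close> has representations
  in \<open>A - A\<close>.  So the SzT-property is used twice: for fixed \<open>u\<close> with the second set \<open>A \<inter> (A - u)\<close>,
  where the exponent \<open>2\<close> produces the square of the number of representations of \<open>u\<close>, and with the
  second set \<open>A\<close> to sum these squares.
\<close>

lemma card_rich_SzT:
  assumes A: "SzT_type 2 A d" and i: "i \<ge> 1"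
  shows "real (card (rich A i)) \<le> 3 * d ^ 2 * real (card A) ^ 4 / real i ^ 4"
proof -
  have finA: "finite A" and d: "d > 0" using A by (simp_all add: SzT_type_def)
  define Y where "Y u = {c \<in> A. c + u \<in> A}" for u
  have finY: "finite (Y u)" for u using finA by (simp add: Y_def)
  have Y: "card (Y u) = diff_reps A A u" for u
    unfolding diff_reps_def
    by (rule bij_betw_same_card[of "\<lambda>c. (c + u, c)"])
      (auto simp: bij_betw_def inj_on_def Y_def image_iff)
  have size_eq: "fibre_size A (u, v) = diff_reps A (Y u) v" for u v
    unfolding diff_reps_def fibre_size_def
    by (rule bij_betw_same_card[of "\<lambda>c. (c + v, c)"])
      (auto simp: bij_betw_def inj_on_def Y_def fibre_def image_iff)
  let ?U = "{u. i \<le> diff_reps A A u}"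
  have finU: "finite {u. t \<le> diff_reps A A u}" if "t \<ge> 1" for t using SzT_type_card(2)[OF A finA that] .
  let ?k = "real (card A)"
  have "rich A i \<subseteq> (SIGMA u:?U. {v. i \<le> diff_reps A (Y u) v})"
  proof
    fix w assume "w \<in> rich A i"
    moreover obtain u v where w: "w = (u, v)" by (meson surj_pair)
    ultimately have le: "i \<le> fibre_size A (u, v)" by (simp add: rich_def)
    also have "fibre_size A (u, v) \<le> card (Y u)"
      unfolding fibre_size_def by (rule card_mono[OF finY]) (auto simp: fibre_def Y_def)
    finally have "i \<le> diff_reps A A u" by (simp add: Y)
    then show "w \<in> (SIGMA u:?U. {v. i \<le> diff_reps A (Y u) v})" using le by (simp add: w size_eq)
  qed
  then have "card (rich A i) \<le> card (SIGMA u:?U. {v. i \<le> diff_reps A (Y u) v})"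
    by (rule card_mono[rotated]) (use finU[OF i] SzT_type_card(2)[OF A finY i] in auto)
  also have "\<dots> = (\<Sum>u\<in>?U. card {v. i \<le> diff_reps A (Y u) v})"
    by (rule card_SigmaI) (use finU[OF i] SzT_type_card(2)[OF A finY i] in auto)
  finally have "real (card (rich A i)) \<le> (\<Sum>u\<in>?U. real (card {v. i \<le> diff_reps A (Y u) v}))"
    by (metis of_nat_mono of_nat_sum)
  also have "\<dots> \<le> (\<Sum>u\<in>?U. d * ?k / real i ^ 3 * real (diff_reps A A u) ^ 2)"
    by (rule sum_mono) (use SzT_type_card(1)[OF A finY i] in \<open>simp add: Y mult_ac\<close>)
  also have "\<dots> = d * ?k / real i ^ 3 * (\<Sum>u\<in>?U. real (diff_reps A A u) ^ 2)"
    by (simp only: sum_distrib_left)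
  also have "\<dots> \<le> d * ?k / real i ^ 3 * (3 * (d * ?k ^ 3) / real i)"
  proof -
    let ?S = "{u. 1 \<le> diff_reps A A u}"
    have S: "{u \<in> ?S. t \<le> diff_reps A A u} = {u. t \<le> diff_reps A A u}" if "t \<ge> 1" for t
      using that by auto
    have "(\<Sum>u\<in>{u \<in> ?S. i \<le> diff_reps A A u}. real (diff_reps A A u) ^ 2) \<le> 3 * (d * ?k ^ 3) / real i"
    proof (rule sum_squares_tail)
      show "real (card {u \<in> ?S. t \<le> diff_reps A A u}) \<le> d * ?k ^ 3 / real t ^ 3" if "1 \<le> t" for t
        using SzT_type_card(1)[OF A finA that] unfolding S[OF that]
        by (simp add: power2_eq_square power3_eq_cube mult_ac)
    qed (use finU d i in auto)
    then show ?thesis unfolding S[OF i] using d by (intro mult_left_mono) auto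
  qed
  also have "\<dots> = 3 * d ^ 2 * ?k ^ 4 / real i ^ 4"
    by (simp add: power2_eq_square power3_eq_cube power4_eq_xxxx)
  finally show ?thesis .
qed

section \<open>Summing over the thresholds\<close>

text \<open>
  The sum telescopes: for \<open>x^3 - y^3 = 1\<close> with \<open>0 \<le> y \<le> x\<close> the factorisation of \<open>x^3 - y^3\<close> gives
  \<open>1 / x^2 \<le> 3 * (x - y)\<close>.
\<close>

lemma sum_powr_minus_two_thirds: "(\<Sum>i=1..s. real i powr (-2/3)) \<le> 3 * real s powr (1/3)"
proof (induction s)
  case (Suc s)
  define x y where "x = real (Suc s) powr (1/3)" and "y = real s powr (1/3)"
  have x: "x > 0" "y \<ge> 0" "y \<le> x" by (auto simp: x_def y_def intro: powr_mono2)
  have "x ^ 3 = real (Suc s)" by (simp add: x_def powr_powr flip: powr_numeral)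
  moreover have "y ^ 3 = real s" by (cases "s = 0") (simp_all add: y_def powr_powr flip: powr_numeral)
  ultimately have "1 = (x - y) * (x ^ 2 + x * y + y ^ 2)"
    by (simp add: power2_eq_square power3_eq_cube algebra_simps)
  also have "\<dots> \<le> (x - y) * (3 * x ^ 2)"
  proof (rule mult_left_mono)
    have "x * y \<le> x * x" "y * y \<le> x * x" using x by (auto intro: mult_mono)
    then show "x ^ 2 + x * y + y ^ 2 \<le> 3 * x ^ 2" by (simp add: power2_eq_square)
  qed (use x in simp)
  finally have "1 / x ^ 2 \<le> 3 * (x - y)" using x by (simp add: field_simps)
  moreover have "1 / x ^ 2 = real (Suc s) powr (-2/3)"
    by (simp add: x_def powr_powr powr_minus_divide flip: powr_numeral)
  ultimately show ?case using Suc unfolding x_def y_def by (simp add: algebra_simps)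
qed simp

text \<open>
  The bounds \<open>k^3 / i\<close> and \<open>3 * d^2 * k^4 / i^4\<close> for the number of rich pairs are of the same order at
  \<open>i = d^(2/3) * k^(1/3)\<close>.  The first is used up to this threshold and the second beyond it.  For
  \<open>d > k\<close> the threshold with \<open>k\<close> in place of \<open>d\<close> is \<open>k\<close> itself, and the first bound covers the
  entire sum.
\<close>

lemma sum_card_rich_powr:
  assumes A: "SzT_type 2 A d" and d: "d \<ge> 1" and k: "card A \<ge> 1"
  shows "(\<Sum>i=1..card A. real (card (rich A i)) powr (2/3))
    \<le> 9 * real (card A) powr (19/9) * min d (real (card A)) powr (2/9)"
proof -
  have finA: "finite A" using A by (simp add: SzT_type_def)
  define k where "k = real (card A)"
  define D where "D = min d k"
  define t where "t = D powr (2/3) * k powr (1/3)"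
  define s where "s = nat \<lfloor>t\<rfloor>"
  have k1: "k \<ge> 1" using k by (simp add: k_def)
  have D: "1 \<le> D" "D \<le> k" "D \<le> d" using d k1 by (auto simp: D_def)
  have t1: "t \<ge> 1"
  proof -
    have "1 * 1 \<le> D powr (2/3) * k powr (1/3)"
      using D k1 by (intro mult_mono) (auto simp: ge_one_powr_ge_zero)
    then show ?thesis by (simp add: t_def)
  qed
  have s: "s \<ge> 1" "real s \<le> t" "t < real s + 1" using t1 by (auto simp: s_def) linarith+
  have tk: "t \<le> k"
  proof -
    have "t \<le> k powr (2/3) * k powr (1/3)"
      unfolding t_def using D by (intro mult_right_mono powr_mono2) auto
    also have "\<dots> = k" using k1 by (simp flip: powr_add)
    finally show ?thesis .
  qed
  have sk: "s \<le> card A" using s tk by (simp add: k_def)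
  let ?N = "\<lambda>i. real (card (rich A i)) powr (2/3)"
  have "(\<Sum>i=1..s. ?N i) \<le> (\<Sum>i=1..s. k powr 2 * real i powr (-2/3))"
  proof (rule sum_mono)
    fix i assume i: "i \<in> {1..s}"
    then have "?N i \<le> (k ^ 3 / real i) powr (2/3)"
      unfolding k_def by (intro powr_mono2 card_rich_trivial finA) auto
    also have "\<dots> = (k powr 3 * real i powr (-1)) powr (2/3)"
      using i k1 by (simp add: powr_minus_divide)
    also have "\<dots> = k powr 2 * real i powr (-2/3)"
      unfolding powr_mult powr_powr by simp
    finally show "?N i \<le> k powr 2 * real i powr (-2/3)" .
  qed
  also have "\<dots> = k powr 2 * (\<Sum>i=1..s. real i powr (-2/3))" by (simp only: sum_distrib_left)
  also have "\<dots> \<le> k powr 2 * (3 * t powr (1/3))"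
    using sum_powr_minus_two_thirds[of s] powr_mono2[of "1/3" "real s" t] s
    by (intro mult_left_mono) auto
  also have "\<dots> = 3 * (k powr (2 + 1/9) * D powr (2/9))"
    unfolding t_def powr_mult powr_powr powr_add by simp
  finally have low: "(\<Sum>i=1..s. ?N i) \<le> 3 * (k powr (19/9) * D powr (2/9))" by simp
  have high: "(\<Sum>i=Suc s..card A. ?N i) \<le> 6 * (k powr (19/9) * D powr (2/9))"
  proof (cases "d \<le> k")
    case False
    then have "t = k" using k1 by (simp add: t_def D_def flip: powr_add)
    then have "s = card A" by (simp add: s_def k_def)
    then show ?thesis by simp
  next
    case True
    then have Dd: "D = d" by (simp add: D_def)
    define c where "c = 3 * (D powr (4/3) * k powr (8/3)) * t powr (-2/3)"
    have c: "c \<ge> 0" by (simp add: c_def)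
    have "(\<Sum>i=Suc s..card A. ?N i) \<le> (\<Sum>i=Suc s..card A. c * (1 / real i ^ 2))"
    proof (rule sum_mono)
      fix i assume i: "i \<in> {Suc s..card A}"
      then have it: "i \<ge> 1" "t \<le> real i" using s by auto
      have "?N i \<le> (3 * d ^ 2 * k ^ 4 / real i ^ 4) powr (2/3)"
        unfolding k_def by (intro powr_mono2 card_rich_SzT[OF A] it) auto
      also have "\<dots> = (3 * (D powr 2 * k powr 4) * real i powr (-4)) powr (2/3)"
        using it k1 d by (simp add: powr_minus_divide Dd mult.assoc)
      also have "\<dots> = 3 powr (2/3) * (D powr (4/3) * k powr (8/3)) * real i powr (-8/3)"
        unfolding powr_mult powr_powr by simp
      \<comment> \<open>Beyond \<open>t\<close> the exponent \<open>-8/3\<close> may be weakened to \<open>-2\<close> at the price of \<open>t powr (-2/3)\<close>.\<close>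
      also have "\<dots> \<le> 3 powr 1 * (D powr (4/3) * k powr (8/3)) * (t powr (-2/3) * real i powr (-2))"
      proof (intro mult_mono mult_nonneg_nonneg)
        show "(3::real) powr (2/3) \<le> 3 powr 1" by (rule powr_mono) auto
        have "real i powr (-8/3) = real i powr (-2/3) * real i powr (-2)" by (simp flip: powr_add)
        also have "\<dots> \<le> t powr (-2/3) * real i powr (-2)"
          using it t1 by (intro mult_right_mono powr_mono2') auto
        finally show "real i powr (-8/3) \<le> t powr (-2/3) * real i powr (-2)" .
      qed auto
      also have "\<dots> = c * (1 / real i ^ 2)" using it by (simp add: c_def powr_minus_divide)
      finally show "?N i \<le> c * (1 / real i ^ 2)" .
    qed
    also have "\<dots> = c * (\<Sum>i=Suc s..card A. 1 / real i ^ 2)" by (simp only: sum_distrib_left)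
    also have "\<dots> \<le> c * (2 / t)"
    proof (rule mult_left_mono[OF _ c])
      have "(\<Sum>i=Suc s..card A. 1 / real i ^ 2) \<le> 1 / real s - 1 / real (card A)"
        by (rule sum_inverse_squares[OF s(1) sk])
      also have "\<dots> \<le> 1 / real s" by simp
      also have "\<dots> \<le> 2 / t" using s t1 of_nat_mono[OF s(1), where ?'a = real] by (simp add: field_simps)
      finally show "(\<Sum>i=Suc s..card A. 1 / real i ^ 2) \<le> 2 / t" .
    qed
    also have "\<dots> = 6 * (D powr (4/3) * k powr (8/3) * t powr (-5/3))"
    proof -
      have "t powr (-5/3) = t powr (-2/3) * t powr (-1)" unfolding powr_add[symmetric] by simp
      also have "t powr (-1) = 1 / t" using t1 by (simp add: powr_minus_divide)
      finally show ?thesis by (simp add: c_def)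
    qed
    also have "D powr (4/3) * k powr (8/3) * t powr (-5/3) = k powr (8/3 + -5/9) * D powr (4/3 + -10/9)"
      unfolding t_def powr_mult powr_powr powr_add by simp
    finally show ?thesis by simp
  qed
  have "(\<Sum>i=1..card A. ?N i) = (\<Sum>i=1..s. ?N i) + (\<Sum>i=Suc s..card A. ?N i)"
    using sum.ub_add_nat[of 1 s ?N "card A - s"] s sk by simp
  also have "\<dots> \<le> 9 * (k powr (19/9) * D powr (2/9))" using low high by simp
  finally show ?thesis by (simp add: D_def k_def mult_ac)
qed

section \<open>Unit-area triangles as weighted incidences\<close>

text \<open>Both weights are decomposed into layers, and the sums are exchanged.\<close>

lemma sum_fibre_size_incidences:
  assumes "finite A" "finite B"
  shows "(\<Sum>(q, l)\<in>incidences spans_unit_area (rich B 1) (rich A 1). fibre_size B q * fibre_size A l)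
    = (\<Sum>j=1..card B. \<Sum>i=1..card A. card (incidences spans_unit_area (rich B j) (rich A i)))"
proof -
  let ?J = "incidences spans_unit_area (rich B 1) (rich A 1)"
  have finJ: "finite ?J"
    by (rule finite_subset[of _ "rich B 1 \<times> rich A 1"])
      (use assms in \<open>auto simp: incidences_def finite_rich\<close>)
  have J: "card (incidences spans_unit_area (rich B j) (rich A i)) =
      (\<Sum>c\<in>?J. if fst c \<in> rich B j \<and> snd c \<in> rich A i then 1 else 0)"
    if "j \<in> {1..card B}" "i \<in> {1..card A}" for i j
  proof -
    have "?J \<inter> {c. fst c \<in> rich B j \<and> snd c \<in> rich A i} = incidences spans_unit_area (rich B j) (rich A i)"
      using rich_antimono[of 1 i A] rich_antimono[of 1 j B] that by (auto simp: incidences_def)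
    then show ?thesis using finJ by (simp add: sum.If_cases)
  qed
  have "(\<Sum>j=1..card B. \<Sum>i=1..card A. card (incidences spans_unit_area (rich B j) (rich A i)))
      = (\<Sum>j=1..card B. \<Sum>i=1..card A. \<Sum>c\<in>?J. if fst c \<in> rich B j \<and> snd c \<in> rich A i then 1 else 0)"
    by (intro sum.cong refl J)
  also have "\<dots> = (\<Sum>j=1..card B. \<Sum>c\<in>?J. \<Sum>i=1..card A. if fst c \<in> rich B j \<and> snd c \<in> rich A i then 1 else 0)"
    by (intro sum.cong refl sum.swap)
  also have "\<dots> = (\<Sum>c\<in>?J. \<Sum>j=1..card B. \<Sum>i=1..card A. if fst c \<in> rich B j \<and> snd c \<in> rich A i then 1 else 0)"
    by (rule sum.swap)
  also have "\<dots> = (\<Sum>c\<in>?J. fibre_size B (fst c) * fibre_size A (snd c))"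
    unfolding fibre_size_layers[OF assms(1)] fibre_size_layers[OF assms(2)] sum_product
    by (intro sum.cong refl) auto
  finally show ?thesis by (simp add: split_beta)
qed

definition cell_triangle :: "(point \<times> point) \<times> (real \<times> real) \<Rightarrow> (real ^ 2) set" where
  "cell_triangle = (\<lambda>((q, l), (z, c)).
     {vector [c, z], vector [c + fst l, z + fst q], vector [c + snd l, z + snd q]})"

text \<open>
  By the determinant formula for the area, one of the two orders of the last two vertices has
  signed area \<open>1\<close>.
\<close>

lemma unit_area_triangles_subset:
  assumes "finite A" "finite B"
  shows "unit_area_triangles (planar_grid A B) \<subseteq>
    cell_triangle ` (SIGMA (q, l):incidences spans_unit_area (rich B 1) (rich A 1). fibre B q \<times> fibre A l)"
proof
  fix T assume "T \<in> unit_area_triangles (planar_grid A B)"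
  then have T: "T \<subseteq> planar_grid A B" "card T = 3" "measure lborel (convex hull T) = 1"
    by (auto simp: unit_area_triangles_def)
  have main: "{P, Q, R} \<in> cell_triangle `
      (SIGMA (q, l):incidences spans_unit_area (rich B 1) (rich A 1). fibre B q \<times> fibre A l)"
    if PQR: "P \<in> planar_grid A B" "Q \<in> planar_grid A B" "R \<in> planar_grid A B"
      and area: "(Q $ 1 - P $ 1) * (R $ 2 - P $ 2) - (R $ 1 - P $ 1) * (Q $ 2 - P $ 2) = 2" for P Q R
  proof -
    let ?l = "(Q $ 1 - P $ 1, R $ 1 - P $ 1)" and ?q = "(Q $ 2 - P $ 2, R $ 2 - P $ 2)"
    have F: "P $ 1 \<in> fibre A ?l" "P $ 2 \<in> fibre B ?q"
      using PQR by (auto simp: fibre_def planar_grid_def)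
    then have "card (fibre A ?l) > 0" "card (fibre B ?q) > 0"
      using assms finite_fibre by (metis card_gt_0_iff empty_iff)+
    then have "(?q, ?l) \<in> incidences spans_unit_area (rich B 1) (rich A 1)"
      using area by (auto simp: incidences_def spans_unit_area_def rich_def fibre_size_def)
    moreover have "cell_triangle ((?q, ?l), (P $ 2, P $ 1)) = {P, Q, R}"
    proof -
      have v: "vector [P' $ 1, P' $ 2] = P'" for P' :: "real ^ 2"
        by (simp add: vec_eq_iff forall_2)
      show ?thesis by (simp add: cell_triangle_def v)
    qed
    ultimately show ?thesis using F
      by (intro image_eqI[of _ _ "((?q, ?l), (P $ 2, P $ 1))"]) auto
  qed
  obtain P Q R where PQR: "T = {P, Q, R}" using T(2) by (auto simp: card_3_iff)
  have disj: "\<bar>x - y\<bar> / 2 = 1 \<Longrightarrow> y - x = 2 \<or> x - y = 2" for x y :: real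
    by (auto simp: abs_if split: if_splits)
  have "\<bar>(R $ 1 - P $ 1) * (Q $ 2 - P $ 2) - (Q $ 1 - P $ 1) * (R $ 2 - P $ 2)\<bar> / 2 = 1"
    using T(3) content_triangle[of P Q R] PQR by simp
  then have "(Q $ 1 - P $ 1) * (R $ 2 - P $ 2) - (R $ 1 - P $ 1) * (Q $ 2 - P $ 2) = 2
    \<or> (R $ 1 - P $ 1) * (Q $ 2 - P $ 2) - (Q $ 1 - P $ 1) * (R $ 2 - P $ 2) = 2"
    by (rule disj)
  then consider "(Q $ 1 - P $ 1) * (R $ 2 - P $ 2) - (R $ 1 - P $ 1) * (Q $ 2 - P $ 2) = 2"
    | "(R $ 1 - P $ 1) * (Q $ 2 - P $ 2) - (Q $ 1 - P $ 1) * (R $ 2 - P $ 2) = 2"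
    by blast
  then show "T \<in> cell_triangle `
      (SIGMA (q, l):incidences spans_unit_area (rich B 1) (rich A 1). fibre B q \<times> fibre A l)"
  proof cases
    case 1
    then show ?thesis using main[of P Q R] T(1) PQR by auto
  next
    case 2
    then show ?thesis using main[of P R Q] T(1) PQR by (auto simp: insert_commute)
  qed
qed

lemma card_unit_area_triangles_le:
  assumes fin: "finite A" "finite B"
  shows "card (unit_area_triangles (planar_grid A B))
    \<le> (\<Sum>j=1..card B. \<Sum>i=1..card A. card (incidences spans_unit_area (rich B j) (rich A i)))"
proof -
  let ?J = "incidences spans_unit_area (rich B 1) (rich A 1)"
  let ?S = "SIGMA (q, l):?J. fibre B q \<times> fibre A l"
  have finJ: "finite ?J"
    by (rule finite_subset[of _ "rich B 1 \<times> rich A 1"])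
      (use fin in \<open>auto simp: incidences_def finite_rich\<close>)
  have finS: "finite ?S" using finJ fin by (auto intro!: finite_SigmaI simp: finite_fibre)
  have "card (unit_area_triangles (planar_grid A B)) \<le> card (cell_triangle ` ?S)"
    by (rule card_mono[OF _ unit_area_triangles_subset[OF fin]]) (use finS in simp)
  also have "\<dots> \<le> card ?S" by (rule card_image_le[OF finS])
  also have "\<dots> = (\<Sum>c\<in>?J. card (case c of (q, l) \<Rightarrow> fibre B q \<times> fibre A l))"
    using finJ fin by (intro card_SigmaI) (auto simp: finite_fibre)
  also have "\<dots> = (\<Sum>(q, l)\<in>?J. fibre_size B q * fibre_size A l)"
    by (intro sum.cong refl) (auto simp: fibre_size_def card_cartesian_product)
  also note sum_fibre_size_incidences[OF fin]
  finally show ?thesis .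
qed

section \<open>The bound on the number of triangles\<close>

text \<open>Test the SzT-property on the singleton \<open>Y = {0}\<close> with threshold \<open>1\<close>.\<close>

lemma SzT_parameter_ge_1:
  assumes "SzT_type 2 A d" "card A \<ge> 1"
  shows "d \<ge> 1"
proof -
  have "{s. 1 \<le> diff_reps A {0} s} = A"
  proof -
    have "{(x, y). x \<in> A \<and> y \<in> {0} \<and> s = x - y} = (if s \<in> A then {(s, 0)} else {})" for s
      by auto
    then show ?thesis by (auto simp: diff_reps_def)
  qed
  then have "real (card A) \<le> d * real (card A)"
    using SzT_type_card(1)[OF assms(1), of "{0}" 1] by simp
  then show ?thesis using assms(2) by simp
qed

text \<open>
  The main term of the Szemeredi--Trotter bound factors over the two thresholds, so that
  \<open>sum_card_rich_powr\<close> applies to each factor.  The linear terms sum to at most \<open>5 * k^4\<close>, because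
  the numbers of rich pairs over all thresholds add up to at most \<open>k^3\<close>.
\<close>

lemma card_unit_area_triangles_SzT:
  assumes A: "SzT_type 2 A dA" and B: "SzT_type 2 B dB"
    and k: "card A = k" "card B = k" "k \<ge> 1"
  shows "real (card (unit_area_triangles (planar_grid A B)))
    \<le> 329 * (real k powr (38/9) * (min dA (real k) * min dB (real k)) powr (2/9))"
proof -
  have fin: "finite A" "finite B" using A B by (simp_all add: SzT_type_def)
  have d: "dA \<ge> 1" "dB \<ge> 1" using SzT_parameter_ge_1 A B k by auto
  let ?NA = "\<lambda>i. real (card (rich A i))" and ?NB = "\<lambda>j. real (card (rich B j))"
  define DA DB where "DA = min dA (real k)" and "DB = min dB (real k)"
  have D: "DA \<ge> 1" "DB \<ge> 1" using d k by (auto simp: DA_def DB_def)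
  have "real (card (unit_area_triangles (planar_grid A B)))
      \<le> (\<Sum>j=1..k. \<Sum>i=1..k. real (card (incidences spans_unit_area (rich B j) (rich A i))))"
    using card_unit_area_triangles_le[OF fin, THEN of_nat_mono, where ?'a = real] k by simp
  also have "\<dots> \<le> (\<Sum>j=1..k. \<Sum>i=1..k. 4 * (?NB j powr (2/3) * ?NA i powr (2/3)) + 4 * ?NB j + ?NA i)"
  proof (intro sum_mono)
    fix i j assume "j \<in> {1..k}" "i \<in> {1..k}"
    then show "real (card (incidences spans_unit_area (rich B j) (rich A i)))
        \<le> 4 * (?NB j powr (2/3) * ?NA i powr (2/3)) + 4 * ?NB j + ?NA i"
      using szemeredi_trotter_difference_pairs[of "rich B j" "rich A i"] fin by (simp add: finite_rich powr_mult)
  qed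
  also have "\<dots> = 4 * ((\<Sum>j=1..k. ?NB j powr (2/3)) * (\<Sum>i=1..k. ?NA i powr (2/3)))
      + 4 * real k * (\<Sum>j=1..k. ?NB j) + real k * (\<Sum>i=1..k. ?NA i)"
  proof -
    have "(\<Sum>j=1..k. \<Sum>i=1..k. 4 * (?NB j powr (2/3) * ?NA i powr (2/3)))
        = 4 * ((\<Sum>j=1..k. ?NB j powr (2/3)) * (\<Sum>i=1..k. ?NA i powr (2/3)))"
      unfolding sum_product by (simp only: sum_distrib_left)
    moreover have "(\<Sum>j=1..k. \<Sum>i=1..k. 4 * ?NB j) = 4 * real k * (\<Sum>j=1..k. ?NB j)"
      by (simp add: sum_distrib_left mult_ac)
    moreover have "(\<Sum>j=1..k. \<Sum>i=1..k. ?NA i) = real k * (\<Sum>i=1..k. ?NA i)" by simp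
    ultimately show ?thesis by (simp only: sum.distrib)
  qed
  also have "\<dots> \<le> 4 * ((9 * real k powr (19/9) * DB powr (2/9)) * (9 * real k powr (19/9) * DA powr (2/9)))
      + 4 * real k * real k ^ 3 + real k * real k ^ 3"
  proof (intro add_mono mult_left_mono mult_mono)
    show "(\<Sum>j=1..k. ?NB j powr (2/3)) \<le> 9 * real k powr (19/9) * DB powr (2/9)"
      using sum_card_rich_powr[OF B d(2)] k by (simp add: DB_def)
    show "(\<Sum>i=1..k. ?NA i powr (2/3)) \<le> 9 * real k powr (19/9) * DA powr (2/9)"
      using sum_card_rich_powr[OF A d(1)] k by (simp add: DA_def)
    show "(\<Sum>j=1..k. ?NB j) \<le> real k ^ 3"
      using sum_card_rich_le[OF fin(2), THEN of_nat_mono, where ?'a = real] k by simp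
    show "(\<Sum>i=1..k. ?NA i) \<le> real k ^ 3"
      using sum_card_rich_le[OF fin(1), THEN of_nat_mono, where ?'a = real] k by simp
  qed (auto intro: sum_nonneg)
  also have "\<dots> = 324 * (real k powr (38/9) * (DA * DB) powr (2/9)) + 5 * real k powr 4"
  proof -
    have "real k powr (38/9) = real k powr (19/9) * real k powr (19/9)" by (simp flip: powr_add)
    then show ?thesis using D k by (simp add: powr_mult power3_eq_cube power4_eq_xxxx)
  qed
  also have "real k powr 4 \<le> real k powr (38/9) * (DA * DB) powr (2/9)"
  proof -
    have "1 * 1 \<le> DA * DB" using D by (intro mult_mono) auto
    then have "real k powr 4 * 1 \<le> real k powr (38/9) * (DA * DB) powr (2/9)"
      using k by (intro mult_mono powr_mono) (auto simp: ge_one_powr_ge_zero)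
    then show ?thesis by simp
  qed
  finally show ?thesis by (simp add: DA_def DB_def)
qed

text \<open>
  The exponent of \<open>b\<close> on the left exceeds that on the right by \<open>2/9 - 2/17 = 16/153\<close>, while
  \<open>37/17 - 19/9 = 10/153\<close> is gained in the exponent of \<open>n\<close>; as \<open>b \<le> sqrt n\<close>, a gain of \<open>8/153\<close> would
  do.  The factor \<open>2\<close> pays for \<open>ln n\<close> being smaller than \<open>1\<close> when \<open>n = 2\<close>.
\<close>

lemma exponent_comparison:
  fixes n a b dA dB :: real
  assumes n: "n \<ge> 2" and a: "1 \<le> a" "a \<le> dA" and b: "1 \<le> b" "b \<le> dB" "b \<le> sqrt n"
  shows "n powr (19/9) * (a * b) powr (2/9)
    \<le> 2 * (n powr (37/17) * (dA ^ 2 * dB * ln n) powr (2/17))"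
proof -
  have b2: "b powr (16/153) \<le> n powr (10/153)"
  proof -
    have "b powr (16/153) \<le> (n powr (1/2)) powr (16/153)"
      using b n by (intro powr_mono2) (auto simp: powr_half_sqrt)
    also have "\<dots> = n powr (8/153)" by (simp add: powr_powr)
    also have "\<dots> \<le> n powr (10/153)" using n by (intro powr_mono) auto
    finally show ?thesis .
  qed
  have ln: "ln n \<ge> 1/2"
  proof -
    have "1/2 \<le> ln (2::real)" using ln2_ge_two_thirds by simp
    also have "\<dots> \<le> ln n" using n by simp
    finally show ?thesis .
  qed
  have "(1/2) powr 1 \<le> (1/2 :: real) powr (2/17)" by (intro powr_mono') auto
  also have "\<dots> \<le> ln n powr (2/17)" using ln by (intro powr_mono2) auto
  finally have ln': "1 \<le> 2 * ln n powr (2/17)" by simp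
  have "n powr (19/9) * (a * b) powr (2/9)
      = n powr (19/9) * (a powr (2/9) * b powr (18/153)) * b powr (16/153)"
  proof -
    have "b powr (2/9) = b powr (18/153) * b powr (16/153)" by (simp flip: powr_add)
    then show ?thesis using a b by (simp add: powr_mult)
  qed
  also have "\<dots> \<le> n powr (19/9) * (dA powr (4/17) * dB powr (2/17)) * n powr (10/153)"
  proof (intro mult_mono mult_left_mono b2)
    have "a powr (2/9) \<le> a powr (4/17)" using a by (intro powr_mono) auto
    also have "\<dots> \<le> dA powr (4/17)" using a by (intro powr_mono2) auto
    finally show "a powr (2/9) \<le> dA powr (4/17)" .
    have "b powr (18/153) = b powr (2/17)" by simp
    also have "\<dots> \<le> dB powr (2/17)" using b by (intro powr_mono2) auto
    finally show "b powr (18/153) \<le> dB powr (2/17)" .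
  qed auto
  also have "\<dots> = n powr (37/17) * (dA ^ 2 * dB) powr (2/17)"
  proof -
    have "n powr (37/17) = n powr (19/9) * n powr (10/153)" by (simp flip: powr_add)
    moreover have "(dA ^ 2 * dB) powr (2/17) = dA powr (4/17) * dB powr (2/17)"
    proof -
      have "dA ^ 2 = dA powr 2" using a by simp
      then show ?thesis using a b by (simp add: powr_mult powr_powr del: powr_numeral)
    qed
    ultimately show ?thesis by simp
  qed
  also have "\<dots> * 1 \<le> n powr (37/17) * (dA ^ 2 * dB) powr (2/17) * (2 * ln n powr (2/17))"
    by (intro mult_left_mono ln') auto
  also have "\<dots> = 2 * (n powr (37/17) * (dA ^ 2 * dB * ln n) powr (2/17))"
    using a b ln by (simp add: powr_mult)
  finally show ?thesis by simp
qed

theorem theorem6: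
  shows "\<exists>C::real. C > 0 \<and>
    (\<forall>(n::nat) (A::real set) (B::real set) (dA::real) (dB::real).
       n \<ge> 2 \<longrightarrow>
       SzT_type 2 A dA \<longrightarrow> SzT_type 2 B dB \<longrightarrow>
       real (card A) = sqrt (real n) \<longrightarrow> real (card B) = sqrt (real n) \<longrightarrow>
       dA \<le> dB \<longrightarrow>
       dB \<le> real n powr (6/47) * dA powr (42/47) * ln (real n) powr (-13/47) \<longrightarrow>
       real (card (unit_area_triangles (planar_grid A B)))
         \<le> C * (real n powr (37/17) * (dA\<^sup>2 * dB * ln (real n)) powr (2/17)))"
proof (intro exI[of _ "658 :: real"] conjI allI impI)
  fix n :: nat and A B :: "real set" and dA dB :: real
  assume n: "n \<ge> 2" and A: "SzT_type 2 A dA" and B: "SzT_type 2 B dB"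
    and cA: "real (card A) = sqrt (real n)" and cB: "real (card B) = sqrt (real n)"
  define k where "k = card A"
  have k: "real k = sqrt (real n)" "card B = k" using cA cB by (simp_all add: k_def)
  have "sqrt (real n) \<ge> 1" using n by simp
  then have k1: "k \<ge> 1" using k by linarith
  have d: "dA \<ge> 1" "dB \<ge> 1" using SzT_parameter_ge_1 A B k k1 by (auto simp: k_def)
  have "real (card (unit_area_triangles (planar_grid A B)))
      \<le> 329 * (real k powr (38/9) * (min dA (real k) * min dB (real k)) powr (2/9))"
    using card_unit_area_triangles_SzT[OF A B k_def[symmetric] k(2) k1] .
  also have "real k powr (38/9) = real n powr (19/9)"
    using n by (simp add: k powr_powr flip: powr_half_sqrt)
  also have "real n powr (19/9) * (min dA (real k) * min dB (real k)) powr (2/9)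
      \<le> 2 * (real n powr (37/17) * (dA ^ 2 * dB * ln (real n)) powr (2/17))"
    by (rule exponent_comparison) (use n d k k1 in auto)
  finally show "real (card (unit_area_triangles (planar_grid A B)))
         \<le> 658 * (real n powr (37/17) * (dA\<^sup>2 * dB * ln (real n)) powr (2/17))" by simp
qed simp

end
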